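(* Let $n\ge 6$. The number $|G(n,n-6)/Z_n|$ of cyclic equivalence classes of $(n-6)$-dissections of a convex regular $n$-gon is \[ \frac{(n-3)(n-4)^2(n-5)}{24n(2n-5)}C_{n-2}+\frac{(n-4)^2}{4n}C_{n/2-2}+\frac{n-3}{9}C_{n/3-1}+\frac{1}{3}C_{n/6-1}. \]
   Context: For $n\ge 3$ and $0\le k\le n-3$, a $k$-dissection of a convex regular $n$-gon is a partition of it into $k+1$ polygons by $k$ pairwise non-crossing diagonals; $G(n,k)$ denotes the set of $k$-dissections (vertices labelled $0,\dots,n-1$ in cyclic order). The cyclic group $Z_n$ acts on $G(n,k)$ by rotation and $G(n,k)/Z_n$ is the set of orbits. For real $m$, $C_m=\frac{1}{m+1}\binom{2m}{m}$ if $m$ is a nonnegative integer and $C_m=0$ otherwise. *)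

theory Defs
  imports Complex_Main "HOL-Algebra.Group_Action" "HOL-Algebra.Elementary_Groups"
begin

text \<open>
  The vertices of the \<open>n\<close>-gon are \<open>0, \<dots>, n - 1\<close> in cyclic order, taken as integers so that they
  match the carrier of \<^const>\<open>integer_mod_group\<close>. A diagonal is the set of its two endpoints.
\<close>

definition diagonals :: "nat \<Rightarrow> int set set" where
  "diagonals n =
     {{i, j} | i j. 0 \<le> i \<and> i + 1 < j \<and> j < int n \<and> \<not> (i = 0 \<and> j = int n - 1)}"

text \<open>
  Chords of a convex polygon cross, i.e. meet in an interior point of both, iff their endpoints
  strictly alternate around the polygon. Diagonals with a common endpoint do not cross.
\<close>

definition crossing :: "int set \<Rightarrow> int set \<Rightarrow> bool" where
  "crossing d e \<longleftrightarrow>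
     (\<exists>a b c f. a < c \<and> c < b \<and> b < f \<and>
        ((d = {a, b} \<and> e = {c, f}) \<or> (d = {c, f} \<and> e = {a, b})))"

text \<open>
  A dissection is identified with its set of diagonals; \<open>k\<close> pairwise non-crossing diagonals always
  cut the polygon into \<open>k + 1\<close> polygons.
\<close>

definition dissections :: "nat \<Rightarrow> nat \<Rightarrow> int set set set" where
  "dissections n k =
     {D. D \<subseteq> diagonals n \<and> finite D \<and> card D = k \<and> (\<forall>d\<in>D. \<forall>e\<in>D. \<not> crossing d e)}"

text \<open>
  The restriction to the acted-upon set is what \<^locale>\<open>group_action\<close> demands (its maps lie in
  \<^const>\<open>BijGroup\<close>, whose elements are extensional).
\<close>

definition rotation :: "nat \<Rightarrow> nat \<Rightarrow> int \<Rightarrow> int set set \<Rightarrow> int set set" where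
  "rotation n k g = (\<lambda>D \<in> dissections n k. (\<lambda>d. (\<lambda>v. (v + g) mod int n) ` d) ` D)"

definition dissection_classes :: "nat \<Rightarrow> nat \<Rightarrow> int set set set set" where
  "dissection_classes n k = orbits (integer_mod_group n) (dissections n k) (rotation n k)"

definition catalan :: "real \<Rightarrow> real" where
  "catalan m =
     (if m \<in> \<nat> then 1 / (m + 1) * real ((2 * nat \<lfloor>m\<rfloor>) choose nat \<lfloor>m\<rfloor>) else 0)"

end

theory Submission
  imports Defs "HOL-Library.Multiset" "HOL-Number_Theory.Totient"
begin

text \<open>
  By Burnside's lemma it suffices to count the dissections fixed by a rotation of order \<open>d\<close>. For
  \<open>d \<ge> 2\<close> and \<open>n = d m\<close>, orienting every diagonal along its shorter side and reducing modulo \<open>m\<close> turns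
  such a dissection into a noncrossing family of directed arcs on \<open>m\<close> points around a puncture, each
  orbit of \<open>d\<close> diagonals becoming one arc; an arc may be a loop around the puncture if \<open>d \<ge> 3\<close>. For every
  multiset of \<open>j\<close> starting points there are \<open>(m - 1) choose j\<close> such families, respectively
  \<open>(m - 2) choose j\<close> without loops: deleting a point that starts no arc but whose predecessor starts
  one yields Pascal's recursion. Families containing a loop are dissections of an \<open>(m + 1)\<close>-gon cut open
  at one of \<open>m\<close> places, which settles \<open>d = 1\<close>. Since \<open>d\<close> divides both \<open>n\<close> and \<open>n - 6\<close>, only
  \<open>d = 1, 2, 3, 6\<close> contribute.
\<close>

section \<open>Noncrossing arc families\<close>

text \<open>Fixing the starting points as a multiset works because the number of families depends
  only on the size of that multiset; summing over all multisets then gives a product of two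
  binomials. The points form an arbitrary finite set of integers, and whether a pair is an edge is
  judged relative to that set, so deleting a point needs no renumbering. The offsets 1 and 2 are the
  sizes of the largest sets that carry no arc, with and without loops.

  Arcs and chords are compared in the universal cover: there both kinds of crossing become overlap
  of integer intervals up to translation, by multiples of \<open>m\<close> for arcs and of
  \<open>d * m\<close> for chords.

  The half turn is exceptional. The \<open>d\<close> lifts of a loop are chords of length
  \<open>m\<close>, and for \<open>d = 2\<close> they collapse to a single diameter; hence the
  loop-free families in that case. A diameter of a symmetric dissection is then excluded by parity,
  since \<open>n - 6\<close> is even whenever \<open>n\<close> is.

  The trivial rotation offers no quotient to count in. Its dissections are obtained from the
  difference between the counts with and without loops.\<close>

text \<open>
  The open arc running upwards from \<open>a\<close> to \<open>b\<close>, wrapping around if necessary; for \<open>a = b\<close> it is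
  everything except \<open>a\<close>, so that the pair \<open>(a, a)\<close> encodes a loop around the whole circle.
\<close>

definition cyc_between :: "int \<Rightarrow> int \<Rightarrow> int set" where
  "cyc_between a b = {x. if a < b then a < x \<and> x < b else a < x \<or> x < b}"

definition arc_cross :: "int \<times> int \<Rightarrow> int \<times> int \<Rightarrow> bool" where
  "arc_cross p q \<longleftrightarrow>
     fst q \<in> cyc_between (fst p) (snd p) \<and> snd p \<in> cyc_between (fst q) (snd q) \<or>
     fst p \<in> cyc_between (fst q) (snd q) \<and> snd q \<in> cyc_between (fst p) (snd p)"

text \<open>The flag \<open>L\<close> permits loops.\<close>

definition arcs :: "bool \<Rightarrow> int set \<Rightarrow> (int \<times> int) set" where
  "arcs L V = {(a, b). a \<in> V \<and> b \<in> V \<and> (a = b \<longrightarrow> L) \<and> V \<inter> cyc_between a b \<noteq> {}}"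

definition arc_families :: "bool \<Rightarrow> int set \<Rightarrow> (int \<times> int) set set" where
  "arc_families L V = {A. A \<subseteq> arcs L V \<and> (\<forall>p\<in>A. \<forall>q\<in>A. \<not> arc_cross p q)}"

definition starts :: "(int \<times> int) set \<Rightarrow> int multiset" where
  "starts A = image_mset fst (mset_set A)"

lemma finite_arcs: "finite V \<Longrightarrow> finite (arcs L V)"
  by (rule finite_subset[of _ "V \<times> V"]) (auto simp: arcs_def)

lemma finite_arc_families: "finite V \<Longrightarrow> finite (arc_families L V)"
  by (rule finite_subset[of _ "Pow (arcs L V)"]) (auto simp: arc_families_def finite_arcs)

lemma arc_family_finite: "A \<in> arc_families L V \<Longrightarrow> finite V \<Longrightarrow> finite A"
  using finite_subset[OF _ finite_arcs[of V L], of A] by (simp add: arc_families_def)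

lemma arc_familyD:
  assumes "A \<in> arc_families L V" "(a, b) \<in> A"
  shows "a \<in> V" "b \<in> V" "a = b \<Longrightarrow> L" "\<exists>c\<in>V. c \<in> cyc_between a b"
  using assms unfolding arc_families_def arcs_def by blast+

lemma in_starts_iff: "finite A \<Longrightarrow> v \<in># starts A \<longleftrightarrow> (\<exists>b. (v, b) \<in> A)"
  by (force simp: starts_def)

lemma size_starts: "size (starts A) = card A"
  by (simp add: starts_def)

text \<open>A discrete intermediate value argument on the circle: a point of \<open>V\<close>
  strictly between \<open>u\<close> and \<open>w\<close> splits the arc into two shorter ones, and
  one of them still leads from inside \<open>P\<close> to outside.\<close>

lemma exists_adjacent_in_out:
  fixes V P :: "int set"
  assumes "finite V" "u \<in> V" "u \<in> P" "w \<in> V" "w \<notin> P"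
  shows "\<exists>u\<in>V. \<exists>w\<in>V. u \<in> P \<and> w \<notin> P \<and> V \<inter> cyc_between u w = {}"
  using assms
proof (induction "card (V \<inter> cyc_between u w)" arbitrary: u w rule: less_induct)
  case less
  show ?case
  proof (cases "V \<inter> cyc_between u w = {}")
    case True
    with less.prems show ?thesis by blast
  next
    case False
    then obtain x where x: "x \<in> V" "x \<in> cyc_between u w" by blast
    have uw: "u \<noteq> w" using less.prems by auto
    have "V \<inter> cyc_between u x \<subset> V \<inter> cyc_between u w"
      using x uw by (auto simp: cyc_between_def split: if_splits)
    moreover have "V \<inter> cyc_between x w \<subset> V \<inter> cyc_between u w"
      using x uw by (auto simp: cyc_between_def split: if_splits)
    ultimately have "card (V \<inter> cyc_between u x) < card (V \<inter> cyc_between u w)"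
      "card (V \<inter> cyc_between x w) < card (V \<inter> cyc_between u w)"
      using less.prems(1) by (simp_all add: psubset_card_mono)
    with less.hyps[of u x] less.hyps[of x w] less.prems x show ?thesis by blast
  qed
qed

lemma exists_cyc_successor:
  fixes V :: "int set"
  assumes "finite V" "w \<in> V" "u \<in> V" "u \<noteq> w"
  obtains w' where "w' \<in> V" "w' \<noteq> w" "V \<inter> cyc_between w w' = {}"
  using exists_adjacent_in_out[of V w "{w}" u] assms by auto

text \<open>
  No arc can end at \<open>w\<close>, since it would cross the arcs starting at \<open>v\<close>. Hence deleting \<open>w\<close> only
  affects the arc \<open>(v, w')\<close>, which degenerates to an edge.
\<close>

lemma arc_family_remove_vertex:
  fixes v w w' :: int
  assumes fin: "finite V" and vw: "v \<in> V" "w \<in> V" "v \<noteq> w" and w': "w' \<in> V" "w' \<noteq> w"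
    and adj: "V \<inter> cyc_between v w = {}" "V \<inter> cyc_between w w' = {}"
    and loop: "v = w' \<Longrightarrow> L"
    and S: "v \<in># S" "w \<notin># S"
  shows "{A \<in> arc_families L V. starts A = S} =
           {A \<in> arc_families L (V - {w}). starts A = S} \<union>
           insert (v, w') ` {A \<in> arc_families L (V - {w}). starts A = S - {#v#}}" (is "?F = ?G \<union> ?H")
    and "(v, w') \<notin> arcs L (V - {w})"
proof -
  have between: "V \<inter> cyc_between v w' = {w}"
  proof -
    have "x = w" if "x \<in> V" "x \<in> cyc_between v w'" for x
    proof -
      have "x \<notin> cyc_between v w" "x \<notin> cyc_between w w'" using that adj by blast+
      with that vw w' show ?thesis by (auto simp: cyc_between_def split: if_splits)
    qed
    moreover have "w \<in> cyc_between v w'"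
    proof -
      have "v \<notin> cyc_between w w'" "w' \<notin> cyc_between v w" using adj vw w' by auto
      with vw(3) w'(2) show ?thesis by (auto simp: cyc_between_def split: if_splits)
    qed
    ultimately show ?thesis using vw by blast
  qed
  show notin: "(v, w') \<notin> arcs L (V - {w})"
    using between by (auto simp: arcs_def)
  have arcs_mono: "arcs L (V - {w}) \<subseteq> arcs L V" by (auto simp: arcs_def)
  have mem_arc: "(v, w') \<in> arcs L V" using vw w' between loop by (auto simp: arcs_def)
  \<comment> \<open>A crossing in either order would put an endpoint of \<open>q\<close> strictly
    inside \<open>(v, w')\<close>, but the only point of \<open>V\<close> there is
    \<open>w\<close>.\<close>
  have nocross: "\<not> arc_cross (v, w') q \<and> \<not> arc_cross q (v, w')" if "q \<in> arcs L (V - {w})" for q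
  proof -
    obtain c d where q: "q = (c, d)" "c \<in> V - {w}" "d \<in> V - {w}"
      using \<open>q \<in> _\<close> by (auto simp: arcs_def)
    hence "c \<notin> cyc_between v w'" "d \<notin> cyc_between v w'" using between by blast+
    thus ?thesis by (simp add: q arc_cross_def)
  qed
  have "\<not> arc_cross (v, w') (v, w')"
    by (auto simp: arc_cross_def cyc_between_def)
  note nocross = nocross this
  show "?F = ?G \<union> ?H"
  proof (intro equalityI subsetI)
    fix A assume "A \<in> ?F"
    hence A: "A \<subseteq> arcs L V" "\<And>p q. p \<in> A \<Longrightarrow> q \<in> A \<Longrightarrow> \<not> arc_cross p q" "starts A = S"
      "A \<in> arc_families L V"
      by (auto simp: arc_families_def)
    have finA: "finite A" using A fin arc_family_finite by blast
    obtain b where b: "(v, b) \<in> A" using S A in_starts_iff[OF finA] by blast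
    have bw: "b \<noteq> w" using arc_familyD(4)[OF A(4) b] adj by auto
    have "b \<notin> cyc_between v w" using arc_familyD(2)[OF A(4) b] adj by blast
    hence wb: "w \<in> cyc_between v b"
      using bw vw by (auto simp: cyc_between_def split: if_splits)
    have end_w: "c \<noteq> w \<and> d \<noteq> w" if cd: "(c, d) \<in> A" for c d
    proof
      show cw: "c \<noteq> w" using cd S A in_starts_iff[OF finA] by blast
      show "d \<noteq> w"
      proof
        assume "d = w"
        have cV: "c \<in> V" and "c \<noteq> v" using arc_familyD[OF A(4) cd] adj \<open>d = w\<close> by auto
        moreover have "c \<notin> cyc_between v w" using cV adj by blast
        ultimately have "v \<in> cyc_between c w"
          using vw cw by (auto simp: cyc_between_def split: if_splits)
        hence "arc_cross (c, w) (v, b)" using wb by (simp add: arc_cross_def)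
        thus False using A(2) cd b \<open>d = w\<close> by blast
      qed
    qed
    \<comment> \<open>An arc stops being an arc after the deletion only if \<open>w\<close> was its
      sole interior point; its endpoints are then the two neighbours of \<open>w\<close>.\<close>
    have shrink: "(c, d) \<in> arcs L (V - {w})" if "(c, d) \<in> A" "(c, d) \<noteq> (v, w')" for c d
    proof -
      have cd: "c \<in> V - {w}" "d \<in> V - {w}" "c = d \<longrightarrow> L" "V \<inter> cyc_between c d \<noteq> {}"
        using that end_w[of c d] arc_familyD[OF A(4), of c d] by auto
      moreover have "(V - {w}) \<inter> cyc_between c d \<noteq> {}"
      proof
        assume "(V - {w}) \<inter> cyc_between c d = {}"
        hence *: "V \<inter> cyc_between c d = {w}" using cd by blast
        have "v = c \<or> v \<notin> cyc_between c d" "w' = d \<or> w' \<notin> cyc_between c d"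
          using * vw w' by auto
        moreover have "c \<notin> cyc_between v w" "d \<notin> cyc_between w w'" "w \<in> cyc_between c d"
          using adj cd * by auto
        ultimately have "c = v \<and> d = w'"
          using vw w' cd by (auto simp: cyc_between_def split: if_splits)
        thus False using that by simp
      qed
      ultimately show ?thesis by (auto simp: arcs_def)
    qed
    show "A \<in> ?G \<union> ?H"
    proof (cases "(v, w') \<in> A")
      case True
      have "A - {(v, w')} \<in> arc_families L (V - {w})"
        using shrink A(2) by (auto simp: arc_families_def)
      moreover have "starts (A - {(v, w')}) = S - {#v#}"
        using True finA A(3)
        by (auto simp: starts_def mset_set_Diff image_mset_Diff)
      ultimately show ?thesis using True by (intro UnI2 image_eqI[of _ _ "A - {(v, w')}"]) auto
    next
      case False
      hence "A \<in> arc_families L (V - {w})"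
        using shrink A(2) by (force simp: arc_families_def)
      thus ?thesis using A by simp
    qed
  next
    fix A assume "A \<in> ?G \<union> ?H"
    thus "A \<in> ?F"
    proof
      assume "A \<in> ?G"
      thus ?thesis using arcs_mono by (auto simp: arc_families_def)
    next
      assume "A \<in> ?H"
      then obtain B where B: "B \<in> arc_families L (V - {w})" "starts B = S - {#v#}"
        "A = insert (v, w') B" by blast
      have "(v, w') \<notin> B" using B notin by (auto simp: arc_families_def)
      hence "starts A = S"
        using B S arc_family_finite[OF B(1)] fin by (simp add: starts_def)
      moreover have "A \<in> arc_families L V"
        using B mem_arc arcs_mono nocross unfolding arc_families_def by blast
      ultimately show ?thesis by simp
    qed
  qed
qed

text \<open>Infinite descent: if every point started an arc, then an arc starting inside
  \<open>(a, b)\<close> could not cross it, hence would be nested strictly inside, and so on with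
  ever fewer interior points.\<close>

lemma arc_family_some_vertex_not_start:
  assumes fin: "finite V" and A: "A \<in> arc_families L V" and "A \<noteq> {}"
  shows "\<exists>w\<in>V. w \<notin># starts A"
proof (rule ccontr)
  assume "\<not> (\<exists>w\<in>V. w \<notin># starts A)"
  hence ex: "\<exists>d. (c, d) \<in> A" if "c \<in> V" for c
    using that in_starts_iff arc_family_finite[OF A fin] by blast
  have False if "(a, b) \<in> A" for a b
    using that
  proof (induction "card (V \<inter> cyc_between a b)" arbitrary: a b rule: less_induct)
    case less
    obtain c where c: "c \<in> V" "c \<in> cyc_between a b"
      using arc_familyD(4)[OF A less.prems] by blast
    obtain d where d: "(c, d) \<in> A" using ex c by blast
    have "\<not> arc_cross (a, b) (c, d)"
      using A less.prems d by (auto simp: arc_families_def)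
    hence "b \<notin> cyc_between c d" "\<not> (a \<in> cyc_between c d \<and> d \<in> cyc_between a b)"
      using c by (auto simp: arc_cross_def)
    hence "cyc_between c d \<subseteq> cyc_between a b - {c}"
      using c by (auto simp: cyc_between_def split: if_splits)
    hence "V \<inter> cyc_between c d \<subset> V \<inter> cyc_between a b" using c by blast
    hence "card (V \<inter> cyc_between c d) < card (V \<inter> cyc_between a b)"
      using fin by (simp add: psubset_card_mono)
    thus False using less.hyps d by blast
  qed
  thus False using \<open>A \<noteq> {}\<close> by auto
qed

lemma card_arc_families_starts:
  assumes "finite V" "set_mset S \<subseteq> V" "(if L then 1 else 2) \<le> card V"
  shows "card {A \<in> arc_families L V. starts A = S} =
           (card V - (if L then 1 else 2)) choose size S"
  using assms
proof (induction "card V" arbitrary: V S rule: less_induct)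
  case less
  note fin = less.prems(1)
  have empty: "starts A = {#} \<longleftrightarrow> A = {}" if "A \<in> arc_families L V" for A
    using arc_family_finite[OF that fin] by (auto simp: starts_def mset_set_empty_iff)
  show ?case
  proof (cases "S = {#}")
    case True
    have "{A \<in> arc_families L V. starts A = S} = {{}}"
      using True empty by (auto simp: arc_families_def starts_def)
    thus ?thesis using True by simp
  next
    case False
    then obtain u where u: "u \<in># S" by blast
    show ?thesis
    proof (cases "card V = (if L then 1 else 2)")
      case True
      have "arcs L V = {}"
      proof (cases L)
        case True
        then obtain x where "V = {x}" using \<open>card V = _\<close> card_1_singletonE by auto
        thus ?thesis by (auto simp: arcs_def cyc_between_def split: if_splits)
      next
        case False
        then obtain x y where "V = {x, y}" using \<open>card V = _\<close> by (auto simp: card_2_iff)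
        thus ?thesis using False by (auto simp: arcs_def cyc_between_def split: if_splits)
      qed
      hence "{A \<in> arc_families L V. starts A = S} = {}"
        using False by (auto simp: arc_families_def starts_def)
      moreover have "0 choose size S = 0" using False by (simp add: binomial_eq_0_iff nonempty_has_size)
      ultimately show ?thesis by (simp only: True diff_self_eq_0 card.empty)
    next
      case big: False
      hence big: "card V > (if L then 1 else 2)" using less.prems by linarith
      show ?thesis
      proof (cases "\<exists>w\<in>V. w \<notin># S")
        \<comment> \<open>If every point of \<open>V\<close> is a start, both sides vanish:
          \<open>size S\<close> exceeds the upper index of the binomial, and no nonempty family
          starts everywhere.\<close>
        case False
        hence "V = set_mset S" using less.prems by auto
        hence "card V \<le> size S"
          by (metis mset_set_set_mset_msubset size_mset_mono size_mset_set)
        hence "card V - (if L then 1 else 2) < size S" using big by (auto split: if_splits)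
        moreover have "{A \<in> arc_families L V. starts A = S} = {}"
          using False arc_family_some_vertex_not_start[OF fin] empty \<open>S \<noteq> {#}\<close> by blast
        ultimately show ?thesis by (simp only: binomial_eq_0 card.empty)
      next
        case True
        then obtain v w where vw: "v \<in> V" "w \<in> V" "v \<in># S" "w \<notin># S" "V \<inter> cyc_between v w = {}"
          using exists_adjacent_in_out[of V u "set_mset S"] fin u less.prems(2) by blast
        hence "v \<noteq> w" by auto
        obtain w' where w': "w' \<in> V" "w' \<noteq> w" "V \<inter> cyc_between w w' = {}"
          using exists_cyc_successor[of V w v] fin vw \<open>v \<noteq> w\<close> by blast
        \<comment> \<open>If the successor of \<open>w\<close> is \<open>v\<close> again, then
          \<open>V\<close> is just \<open>{v, w}\<close>; without loops this is the base case,
          already excluded by \<open>big\<close>.\<close>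
        have loop: "L" if "v = w'"
        proof (rule ccontr)
          assume "\<not> L"
          have "x = v \<or> x = w" if "x \<in> V" for x
          proof -
            have "x \<notin> cyc_between v w" "x \<notin> cyc_between w v"
              using that vw(5) w'(3) \<open>v = w'\<close> by blast+
            thus ?thesis using \<open>v \<noteq> w\<close> by (auto simp: cyc_between_def split: if_splits)
          qed
          hence "V \<subseteq> {v, w}" by blast
          hence "card V \<le> card {v, w}" by (intro card_mono) auto
          thus False using big \<open>\<not> L\<close> \<open>v \<noteq> w\<close> by simp
        qed
        let ?G = "{A \<in> arc_families L (V - {w}). starts A = S}"
        let ?H = "{A \<in> arc_families L (V - {w}). starts A = S - {#v#}}"
        note rem = arc_family_remove_vertex[OF fin vw(1,2) \<open>v \<noteq> w\<close> w'(1,2) vw(5) w'(3) loop vw(3,4)]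
        have cardV: "card (V - {w}) = card V - 1" "card V - 1 < card V"
          using fin vw card_gt_0_iff[of V] by auto
        have G: "card ?G = (card (V - {w}) - (if L then 1 else 2)) choose size S"
          using less.hyps[of "V - {w}" S] fin less.prems(2) vw cardV big by (auto simp: Diff_eq split: if_splits)
        have "set_mset (S - {#v#}) \<subseteq> V - {w}"
          using less.prems(2) vw(4) by (auto dest: in_diffD)
        hence H: "card ?H = (card (V - {w}) - (if L then 1 else 2)) choose size (S - {#v#})"
          using less.hyps[of "V - {w}" "S - {#v#}"] fin cardV big by (auto split: if_splits)
        have fin': "finite ?G" "finite ?H"
          using finite_arc_families[of "V - {w}" L] fin by auto
        have notin: "(v, w') \<notin> A" if "A \<in> arc_families L (V - {w})" for A
          using that rem(2) by (auto simp: arc_families_def)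
        hence "inj_on (insert (v, w')) ?H"
          by (intro inj_onI) (metis (no_types, lifting) insert_ident mem_Collect_eq)
        moreover have "?G \<inter> insert (v, w') ` ?H = {}" using notin by blast
        ultimately have "card {A \<in> arc_families L V. starts A = S} = card ?G + card ?H"
          using fin' by (subst rem(1)) (simp_all add: card_Un_disjoint card_image)
        moreover obtain k where "card V - (if L then 1 else 2) = Suc k"
          using big by (metis Suc_diff_Suc)
        moreover have "card (V - {w}) - (if L then 1 else 2) = k"
          using calculation(2) cardV by linarith
        moreover obtain j where "size S = Suc j" "size (S - {#v#}) = j"
          using vw(3) by (metis size_Suc_Diff1)
        ultimately show ?thesis using G H by simp
      qed
    qed
  qed
qed

text \<open>The second factor counts the multisets of \<open>j\<close> starting points, each of
  which contributes the first factor. With loops the product is the number of faces of codimension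
  \<open>j\<close> of the cyclohedron of dimension \<open>card V - 1\<close>.\<close>

theorem card_arc_families:
  assumes "finite V" "(if L then 1 else 2) \<le> card V"
  shows "card {A \<in> arc_families L V. card A = j} =
           ((card V - (if L then 1 else 2)) choose j) * ((card V + j - 1) choose j)"
proof -
  let ?F = "\<lambda>S. {A \<in> arc_families L V. starts A = S}"
  have "{A \<in> arc_families L V. card A = j} = (\<Union>S\<in>multisets_of_size V j. ?F S)"
  proof -
    have "starts A \<in> multisets_of_size V j \<longleftrightarrow> card A = j" if "A \<in> arc_families L V" for A
    proof -
      have "set_mset (starts A) \<subseteq> V"
        using arc_family_finite[OF that assms(1)] that
        by (auto simp: starts_def arc_families_def arcs_def)
      thus ?thesis by (auto simp: multisets_of_size_def size_starts)
    qed
    thus ?thesis by auto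
  qed
  also have "card \<dots> = (\<Sum>S\<in>multisets_of_size V j. card (?F S))"
    using assms finite_arc_families[of V L] by (intro card_UN_disjoint) auto
  also have "\<dots> = (\<Sum>S\<in>multisets_of_size V j. (card V - (if L then 1 else 2)) choose j)"
    using card_arc_families_starts[OF assms(1) _ assms(2)]
    by (intro sum.cong) (auto simp: multisets_of_size_def)
  also have "\<dots> = ((card V - (if L then 1 else 2)) choose j) * ((card V + j - 1) choose j)"
    by (simp add: card_multisets_of_size[OF assms(1)])
  finally show ?thesis .
qed

section \<open>Chords and arcs lifted to the integers\<close>

text \<open>The intervals \<open>[x, x + l]\<close> and \<open>[y, y + k]\<close> overlap without being nested.\<close>

definition int_cross :: "int \<Rightarrow> int \<Rightarrow> int \<Rightarrow> int \<Rightarrow> bool" where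
  "int_cross x l y k \<longleftrightarrow> x < y \<and> y < x + l \<and> x + l < y + k \<or> y < x \<and> x < y + k \<and> y + k < x + l"

definition chord :: "int \<Rightarrow> int \<Rightarrow> int \<Rightarrow> int set" where
  "chord N x l = {x mod N, (x + l) mod N}"

text \<open>Equal endpoints give the full length \<open>m\<close> and not 0, in keeping with loops
  as arcs going once around.\<close>

definition arc_len :: "int \<Rightarrow> int \<Rightarrow> int \<Rightarrow> int" where
  "arc_len m a b = (if a < b then b - a else b - a + m)"

section \<open>Betweenness and crossing of arcs in the universal cover\<close>

lemma int_multiple_small:
  fixes t N :: int
  assumes "-N < t * N" "t * N < N"
  shows "t = 0"
proof -
  have "N > 0" using assms by linarith
  have "t < 1" using assms(2) \<open>N > 0\<close> by (metis mult_less_cancel_right_disj mult_1 order_less_not_sym)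
  moreover have "-1 < t" using assms(1) \<open>N > 0\<close>
    by (metis mult_less_cancel_right_disj mult_minus1 order_less_not_sym)
  ultimately show ?thesis by simp
qed

text \<open>An open window of length \<open>N\<close> meets each residue class at most once. This
  identifies shifts that stem from separate existential quantifiers.\<close>

lemma shift_unique:
  fixes p t u N x :: int
  assumes "x < p + t * N" "p + t * N < x + N" "x < p + u * N" "p + u * N < x + N"
  shows "t = u"
proof -
  have "-N < (t - u) * N" "(t - u) * N < N" using assms by (simp_all add: left_diff_distrib)
  thus ?thesis using int_multiple_small[of N "t - u"] by simp
qed

lemma mod_add_length:
  fixes x l N :: int
  assumes "1 \<le> l" "l \<le> N"
  shows "(x + l) mod N = (if x mod N + l < N then x mod N + l else x mod N + l - N)"
proof -
  have N: "N > 0" using assms by simp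
  have b: "0 \<le> x mod N" "x mod N < N" using N by auto
  have "(x + l) mod N = (x mod N + l) mod N" by (simp add: mod_add_left_eq)
  also have "\<dots> = (if x mod N + l < N then x mod N + l else x mod N + l - N)"
  proof (cases "x mod N + l < N")
    case True thus ?thesis using b assms by (simp add: mod_pos_pos_trivial)
  next
    case False
    have "(x mod N + l) mod N = (x mod N + l - N) mod N" by simp
    also have "\<dots> = x mod N + l - N"
      by (rule mod_pos_pos_trivial) (use False b assms in linarith)+
    finally show ?thesis using False by simp
  qed
  finally show ?thesis .
qed

lemma mod_in_cyc_between_iff:
  fixes x y l N :: int
  assumes l: "1 \<le> l" "l \<le> N"
  shows "y mod N \<in> cyc_between (x mod N) ((x + l) mod N) \<longleftrightarrow> (\<exists>t. x < y + t * N \<and> y + t * N < x + l)"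
proof -
  define a c where "a = x mod N" and "c = y mod N"
  have N: "N > 0" using l by simp
  have b: "0 \<le> a" "a < N" "0 \<le> c" "c < N" using N by (auto simp: a_def c_def)
  have x: "x = a + (x div N) * N" and y: "y = c + (y div N) * N" by (simp_all add: a_def c_def)
  have "(\<exists>t. x < y + t * N \<and> y + t * N < x + l) \<longleftrightarrow> a < c \<and> c < a + l \<or> c + N < a + l"
  proof
    assume "\<exists>t. x < y + t * N \<and> y + t * N < x + l"
    then obtain t where t: "x < y + t * N" "y + t * N < x + l" by blast
    define u where "u = y div N + t - x div N"
    have u: "a < c + u * N" "c + u * N < a + l"
      using t x y by (simp_all add: u_def algebra_simps)
    \<comment> \<open>With representatives in \<open>[0, N)\<close> and \<open>l\<close> at most
      \<open>N\<close>, only the current and the next copy of \<open>c\<close> can lie in the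
      window.\<close>
    have "-1 < u"
    proof (rule ccontr)
      assume "\<not> -1 < u"
      hence "u * N \<le> (-1) * N" using N by (intro mult_right_mono) auto
      thus False using u b by simp
    qed
    moreover have "u < 2"
    proof (rule ccontr)
      assume "\<not> u < 2"
      hence "2 * N \<le> u * N" using N by (intro mult_right_mono) auto
      thus False using u b l by linarith
    qed
    ultimately have "u = 0 \<or> u = 1" by auto
    thus "a < c \<and> c < a + l \<or> c + N < a + l" using u by auto
  next
    assume "a < c \<and> c < a + l \<or> c + N < a + l"
    thus "\<exists>t. x < y + t * N \<and> y + t * N < x + l"
    proof
      assume "a < c \<and> c < a + l"
      thus ?thesis using x y by (intro exI[of _ "x div N - y div N"]) (simp add: algebra_simps)
    next
      assume "c + N < a + l"
      thus ?thesis using x y b by (intro exI[of _ "x div N - y div N + 1"]) (simp add: algebra_simps)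
    qed
  qed
  also have "\<dots> \<longleftrightarrow> c \<in> cyc_between a ((x + l) mod N)"
    using b l by (auto simp: mod_add_length[OF l] cyc_between_def a_def[symmetric])
  finally show ?thesis by (simp add: a_def c_def)
qed

lemma arc_cross_mod_iff:
  fixes x y k l N :: int
  assumes l: "1 \<le> l" "l \<le> N" and k: "1 \<le> k" "k \<le> N"
  shows "arc_cross (x mod N, (x + l) mod N) (y mod N, (y + k) mod N) \<longleftrightarrow>
           (\<exists>t. int_cross x l (y + t * N) k)"
proof
  \<comment> \<open>The two membership conditions bring independent shifts. Both place
    \<open>x + l\<close> into the window of length \<open>N\<close> after \<open>y\<close>, so they
    agree up to sign.\<close>
  have one: "\<exists>t. x < y + t * N \<and> y + t * N < x + l \<and> x + l < y + t * N + k"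
    if lk: "1 \<le> l" "l \<le> N" "1 \<le> k" "k \<le> N"
      and "x < y + t * N" "y + t * N < x + l" "y < x + l + u * N" "x + l + u * N < y + k"
    for x l y k t u :: int
  proof -
    have "-t = u"
      using shift_unique[of y "x + l" "-t" N u] that by simp
    thus ?thesis using that by (intro exI[of _ t]) auto
  qed
  assume "arc_cross (x mod N, (x + l) mod N) (y mod N, (y + k) mod N)"
  hence "(\<exists>t. x < y + t * N \<and> y + t * N < x + l) \<and> (\<exists>t. y < x + l + t * N \<and> x + l + t * N < y + k) \<or>
         (\<exists>t. y < x + t * N \<and> x + t * N < y + k) \<and> (\<exists>t. x < y + k + t * N \<and> y + k + t * N < x + l)"
    by (simp only: arc_cross_def mod_in_cyc_between_iff[OF l] mod_in_cyc_between_iff[OF k] fst_conv snd_conv)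
  thus "\<exists>t. int_cross x l (y + t * N) k"
  proof (elim disjE conjE exE)
    fix t u
    assume "x < y + t * N" "y + t * N < x + l" "y < x + l + u * N" "x + l + u * N < y + k"
    from one[OF l k this] show ?thesis by (auto simp: int_cross_def)
  next
    fix t u
    assume "y < x + t * N" "x + t * N < y + k" "x < y + k + u * N" "y + k + u * N < x + l"
    from one[OF k l this] obtain t where "y < x + t * N \<and> x + t * N < y + k \<and> y + k < x + t * N + l"
      by blast
    thus ?thesis by (intro exI[of _ "-t"]) (auto simp: int_cross_def)
  qed
next
  assume "\<exists>t. int_cross x l (y + t * N) k"
  then obtain t where "int_cross x l (y + t * N) k" by blast
  hence "x < y + t * N \<and> y + t * N < x + l \<and> y < x + l + (-t) * N \<and> x + l + (-t) * N < y + k \<or>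
         y < x + (-t) * N \<and> x + (-t) * N < y + k \<and> x < y + k + t * N \<and> y + k + t * N < x + l"
    by (auto simp: int_cross_def)
  hence "(\<exists>t. x < y + t * N \<and> y + t * N < x + l) \<and> (\<exists>t. y < x + l + t * N \<and> x + l + t * N < y + k) \<or>
         (\<exists>t. y < x + t * N \<and> x + t * N < y + k) \<and> (\<exists>t. x < y + k + t * N \<and> y + k + t * N < x + l)"
    by blast
  thus "arc_cross (x mod N, (x + l) mod N) (y mod N, (y + k) mod N)"
    by (simp only: arc_cross_def mod_in_cyc_between_iff[OF l] mod_in_cyc_between_iff[OF k] fst_conv snd_conv)
qed

text \<open>Alternation in the linear order is restated as separation on the circle: the second
  chord has one endpoint on each side of the first. This form no longer depends on where the
  labelling begins.\<close>

lemma crossing_iff_cyc_between: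
  assumes "p \<noteq> q"
  shows "crossing {p, q} {r, s} \<longleftrightarrow>
           r \<in> cyc_between p q \<and> s \<in> cyc_between q p \<or> s \<in> cyc_between p q \<and> r \<in> cyc_between q p"
proof
  assume "crossing {p, q} {r, s}"
  thus "r \<in> cyc_between p q \<and> s \<in> cyc_between q p \<or> s \<in> cyc_between p q \<and> r \<in> cyc_between q p"
    by (elim crossing_def[THEN iffD1, THEN exE] exE conjE disjE)
       (auto simp: crossing_def doubleton_eq_iff cyc_between_def)
next
  have lt: "crossing {p, q} {r, s}" if "p < q" "r \<in> cyc_between p q" "s \<in> cyc_between q p" for p q r s
  proof (cases "s < p")
    case True
    \<comment> \<open>Here \<open>s < p < r < q\<close>, so the second chord begins first and the
      chords exchange roles in \<open>crossing_def\<close>.\<close>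
    have "crossing {p, q} {s, r}"
      unfolding crossing_def
      by (rule exI[of _ s], rule exI[of _ r], rule exI[of _ p], rule exI[of _ q])
         (use that True in \<open>auto simp: cyc_between_def\<close>)
    thus ?thesis by (simp add: insert_commute)
  next
    case False
    show ?thesis
      unfolding crossing_def
      by (rule exI[of _ p], rule exI[of _ q], rule exI[of _ r], rule exI[of _ s])
         (use that False in \<open>auto simp: cyc_between_def\<close>)
  qed
  assume "r \<in> cyc_between p q \<and> s \<in> cyc_between q p \<or> s \<in> cyc_between p q \<and> r \<in> cyc_between q p"
  thus "crossing {p, q} {r, s}"
    using lt[of p q r s] lt[of p q s r] lt[of q p r s] lt[of q p s r] assms
    by (cases "p < q") (auto simp: insert_commute)
qed

lemma mod_shift_neq:
  fixes x l N :: int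
  assumes "1 \<le> l" "l < N"
  shows "x mod N \<noteq> (x + l) mod N"
  using assms by (auto simp: mod_add_length)

lemma crossing_chord_iff_ex:
  fixes x y l N :: int
  assumes l: "1 \<le> l" "l < N"
  shows "crossing (chord N x l) (chord N y k) \<longleftrightarrow>
    (\<exists>t. x < y + t * N \<and> y + t * N < x + l) \<and> (\<exists>t. x + l < y + k + t * N \<and> y + k + t * N < x + N) \<or>
    (\<exists>t. x < y + k + t * N \<and> y + k + t * N < x + l) \<and> (\<exists>t. x + l < y + t * N \<and> y + t * N < x + N)"
proof -
  have 1: "z mod N \<in> cyc_between (x mod N) ((x + l) mod N) \<longleftrightarrow> (\<exists>t. x < z + t * N \<and> z + t * N < x + l)" for z
    using l by (intro mod_in_cyc_between_iff) auto
  have 2: "z mod N \<in> cyc_between ((x + l) mod N) (x mod N) \<longleftrightarrow>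
      (\<exists>t. x + l < z + t * N \<and> z + t * N < x + N)" for z
    using mod_in_cyc_between_iff[of "N - l" N z "x + l"] l by simp
  show ?thesis
    unfolding chord_def using crossing_iff_cyc_between[OF mod_shift_neq[OF l]] by (simp only: 1 2)
qed

text \<open>Two intervals that overlap without nesting span less than \<open>l + k\<close>, which is
  at most \<open>N\<close>; the far endpoint therefore cannot wrap around into the first interval.
  The right-hand side has the same form as for directed arcs, which is what makes lifting respect
  crossings.\<close>

lemma crossing_chord_iff:
  fixes x y k l N :: int
  assumes l: "1 \<le> l" "1 \<le> k" "l + k \<le> N"
  shows "crossing (chord N x l) (chord N y k) \<longleftrightarrow> (\<exists>t. int_cross x l (y + t * N) k)"
proof -
  have "l < N" using l by simp
  note iff = crossing_chord_iff_ex[OF l(1) \<open>l < N\<close>]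
  show ?thesis
  proof
    assume "crossing (chord N x l) (chord N y k)"
    thus "\<exists>t. int_cross x l (y + t * N) k"
      unfolding iff
    proof (elim disjE conjE exE)
      fix t u
      assume *: "x < y + t * N" "y + t * N < x + l" "x + l < y + k + u * N" "y + k + u * N < x + N"
      have "t = u" using shift_unique[of x "y + k" t N u] * l by linarith
      thus ?thesis using * by (intro exI[of _ t]) (auto simp: int_cross_def)
    next
      fix t u
      assume *: "x < y + k + t * N" "y + k + t * N < x + l" "x + l < y + u * N" "y + u * N < x + N"
      \<comment> \<open>The start is found beyond \<open>x + l\<close>, so the copy of the interval
        that ends inside \<open>(x, x + l)\<close> begins one full turn earlier.\<close>
      have "t = u - 1"
        using shift_unique[of "x + l - N" y t N "u - 1"] * l by (simp add: left_diff_distrib)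
      thus ?thesis using * by (intro exI[of _ t]) (auto simp: int_cross_def left_diff_distrib)
    qed
  next
    assume "\<exists>t. int_cross x l (y + t * N) k"
    then obtain t where t: "int_cross x l (y + t * N) k" by blast
    hence "x < y + t * N \<and> y + t * N < x + l \<and> x + l < y + k + t * N \<and> y + k + t * N < x + N \<or>
           x < y + k + t * N \<and> y + k + t * N < x + l \<and> x + l < y + (t + 1) * N \<and> y + (t + 1) * N < x + N"
      using l by (auto simp: int_cross_def distrib_right)
    thus "crossing (chord N x l) (chord N y k)"
      unfolding iff by blast
  qed
qed

section \<open>Normal forms of chords and diagonals\<close>

lemma int_cross_translate: "int_cross (x + z) l (y + z) k \<longleftrightarrow> int_cross x l y k"
  by (auto simp: int_cross_def)

lemma rotate_chord: "(\<lambda>v. (v + g) mod N) ` chord N x l = chord N (x + g) l"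
proof -
  have "(x + l + g) mod N = (x + g + l) mod N" by (simp add: ac_simps)
  thus ?thesis by (simp add: chord_def mod_add_left_eq)
qed

lemma chord_shift: "chord N (x + t * N) l = chord N x l"
  by (simp add: chord_def) (metis add.assoc add.commute mod_mult_self1)

lemma chord_mod: "chord N (x mod N) l = chord N x l"
  by (simp add: chord_def mod_add_left_eq)

text \<open>If the endpoints matched crosswise, walking along both lengths would close up, forcing
  \<open>N\<close> to divide \<open>l + k\<close>. The strict bound excludes exactly the case of one
  chord read from its two sides, such as a diameter.\<close>

lemma chord_eqD:
  fixes x y k l N :: int
  assumes "chord N x l = chord N y k" and l: "1 \<le> l" "1 \<le> k" "l + k < N"
  shows "x mod N = y mod N" "l = k"
proof -
  have "x mod N = y mod N \<and> (x + l) mod N = (y + k) mod N"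
  proof (rule ccontr)
    assume "\<not> ?thesis"
    hence *: "x mod N = (y + k) mod N" "(x + l) mod N = y mod N"
      using assms(1) by (auto simp: chord_def doubleton_eq_iff)
    have "(y + (k + l)) mod N = (x + l) mod N"
      using *(1) by (metis add.assoc mod_add_left_eq)
    thus False using * mod_shift_neq[of "k + l" N y] l by simp
  qed
  thus "x mod N = y mod N" "l = k"
    using l by (auto simp: mod_add_length split: if_splits)
qed

lemma chord_in_diagonals:
  assumes "2 \<le> l" "l + 2 \<le> int n"
  shows "chord (int n) x l \<in> diagonals n"
proof -
  define a where "a = x mod int n"
  have a: "0 \<le> a" "a < int n" using assms by (auto simp: a_def)
  have e: "chord (int n) x l = {a, if a + l < int n then a + l else a + l - int n}"
    using assms by (simp add: chord_def mod_add_length a_def)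
  show ?thesis
  proof (cases "a + l < int n")
    case True
    thus ?thesis unfolding diagonals_def e using a assms
      by (intro CollectI exI[of _ a] exI[of _ "a + l"]) auto
  next
    case False
    thus ?thesis unfolding diagonals_def e using a assms
      by (intro CollectI exI[of _ "a + l - int n"] exI[of _ a]) auto
  qed
qed

lemma diagonals_chordE:
  assumes "\<delta> \<in> diagonals n"
  obtains x l where "\<delta> = chord (int n) x l" "2 \<le> l" "2 * l \<le> int n"
proof -
  obtain i j where ij: "\<delta> = {i, j}" "0 \<le> i" "i + 1 < j" "j < int n" "\<not> (i = 0 \<and> j = int n - 1)"
    using assms by (auto simp: diagonals_def)
  show ?thesis
  proof (cases "2 * (j - i) \<le> int n")
    case True
    have "\<delta> = chord (int n) i (j - i)"
      using ij by (simp add: chord_def)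
    thus ?thesis using that[of i "j - i"] ij True by simp
  next
    case False
    have "\<delta> = chord (int n) j (int n - (j - i))"
      using ij by (auto simp: chord_def)
    moreover have "2 \<le> int n - (j - i)" "2 * (int n - (j - i)) \<le> int n" using ij False by auto
    ultimately show ?thesis using that by blast
  qed
qed

section \<open>Arcs described by a start and a length\<close>

lemma arc_len_bounds:
  assumes "0 \<le> a" "a < m" "0 \<le> b" "b < m"
  shows "1 \<le> arc_len m a b" "arc_len m a b \<le> m" "(a + arc_len m a b) mod m = b"
    "arc_len m a b = m \<longleftrightarrow> a = b"
  using assms by (auto simp: arc_len_def)

lemma arc_len_mod:
  fixes x l m :: int
  assumes "1 \<le> l" "l \<le> m"
  shows "arc_len m (x mod m) ((x + l) mod m) = l"
  using assms by (auto simp: arc_len_def mod_add_length)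

lemma arc_len_ge_2:
  assumes "(a, b) \<in> arcs L {0..<m}"
  shows "2 \<le> arc_len m a b"
proof -
  have ab: "0 \<le> a" "a < m" "0 \<le> b" "b < m" using assms by (auto simp: arcs_def)
  obtain c where c: "0 \<le> c" "c < m" "c \<in> cyc_between a b" using assms by (auto simp: arcs_def)
  show ?thesis using ab c by (auto simp: arc_len_def cyc_between_def split: if_splits)
qed

lemma mod_pair_in_arcs:
  fixes x l m :: int
  assumes l: "2 \<le> l" "l \<le> m" and "l = m \<Longrightarrow> L"
  shows "(x mod m, (x + l) mod m) \<in> arcs L {0..<m}"
proof -
  have "(x + 1) mod m \<in> cyc_between (x mod m) ((x + l) mod m)"
    using l by (subst mod_in_cyc_between_iff) (auto intro!: exI[of _ 0])
  moreover have "l = m" if "x mod m = (x + l) mod m"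
    using that l mod_shift_neq[of l m x] by fastforce
  moreover have "(x + 1) mod m \<in> {0..<m}" using l by simp
  ultimately have "{0..<m} \<inter> cyc_between (x mod m) ((x + l) mod m) \<noteq> {}" by blast
  with \<open>x mod m = (x + l) mod m \<Longrightarrow> l = m\<close> show ?thesis using assms by (auto simp: arcs_def)
qed

section \<open>Dissections with rotational symmetry\<close>

definition noncrossing :: "int set set \<Rightarrow> bool" where
  "noncrossing D \<longleftrightarrow> (\<forall>d\<in>D. \<forall>e\<in>D. \<not> crossing d e)"

text \<open>Unlike \<open>rotation\<close>, defined on all sets of chords and not tied to a number
  of diagonals, so it also applies to lifts and to dissections with a diagonal removed.\<close>

definition rot :: "nat \<Rightarrow> int \<Rightarrow> int set set \<Rightarrow> int set set" where
  "rot n g D = (\<lambda>d. (\<lambda>v. (v + g) mod int n) ` d) ` D"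

text \<open>The natural number selects one of the sectors of \<open>m\<close> consecutive vertices,
  hence one of the preimages of the arc under reduction modulo \<open>m\<close>.\<close>

definition lift_arc :: "nat \<Rightarrow> nat \<Rightarrow> (int \<times> int) \<times> nat \<Rightarrow> int set" where
  "lift_arc n m p =
     chord (int n) (fst (fst p) + int (snd p) * int m) (arc_len (int m) (fst (fst p)) (snd (fst p)))"

definition lift_family :: "nat \<Rightarrow> nat \<Rightarrow> (int \<times> int) set \<Rightarrow> int set set" where
  "lift_family d m A = lift_arc (d * m) m ` (A \<times> {0..<d})"

text \<open>Diameters are excluded for \<open>d = 2\<close> because there a loop would lift to a single chord.\<close>

definition periodic_dissections :: "nat \<Rightarrow> nat \<Rightarrow> int set set set" where
  "periodic_dissections d m =
     {D. D \<subseteq> diagonals (d * m) \<and> noncrossing D \<and> rot (d * m) (int m) D = D \<and>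
         (d = 2 \<longrightarrow> (\<forall>x. chord (int (d * m)) x (int m) \<notin> D))}"

lemma rot_memD:
  assumes "rot n g D = D"
  shows "chord (int n) x l \<in> D \<Longrightarrow> chord (int n) (x + int t * g) l \<in> D"
proof (induction t)
  case (Suc t)
  have "(\<lambda>v. (v + g) mod int n) ` chord (int n) (x + int t * g) l \<in> D"
    using Suc assms by (auto simp: rot_def)
  thus ?case by (simp add: rotate_chord algebra_simps)
qed simp

text \<open>The strict bound on \<open>2 * l\<close> is the essential one: it lets
  \<open>chord_eqD\<close> and \<open>crossing_chord_iff\<close> apply to any two lifts. For
  \<open>d \<ge> 3\<close> it follows from \<open>l \<le> m\<close>, for \<open>d = 2\<close> from
  the absence of loops.\<close>

lemma lift_arc_props:
  assumes d: "d \<ge> 2" and p: "p \<in> arcs (d \<ge> 3) {0..<int m}"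
  defines "l \<equiv> arc_len (int m) (fst p) (snd p)"
  shows "2 \<le> l" "l \<le> int m" "2 * l < int (d * m)" "d = 2 \<Longrightarrow> l < int m"
    "p = (fst p mod int m, (fst p + l) mod int m)"
proof -
  have ab: "0 \<le> fst p" "fst p < int m" "0 \<le> snd p" "snd p < int m" "fst p = snd p \<Longrightarrow> d \<ge> 3"
    using p by (auto simp: arcs_def)
  note len = arc_len_bounds[OF ab(1-4)]
  show 2: "2 \<le> l" using arc_len_ge_2[of "fst p" "snd p"] p by (simp add: l_def)
  show m: "l \<le> int m" using len by (simp add: l_def)
  show less: "l < int m" if "d = 2"
    using len(2,4) ab(5) that by (cases "fst p = snd p") (auto simp: l_def)
  show "2 * l < int (d * m)"
  proof (cases "d = 2")
    case False
    hence "3 * int m \<le> int d * int m" using d by (intro mult_right_mono) auto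
    thus ?thesis using 2 m unfolding of_nat_mult by linarith
  qed (use less in simp)
  show "p = (fst p mod int m, (fst p + l) mod int m)"
    using len ab by (simp add: l_def)
qed

text \<open>A lift is shorter than half the polygon, so the chord determines its length and its
  start; division of the start by \<open>m\<close> returns the sector and the starting
  point.\<close>

lemma inj_on_lift_arc:
  assumes d: "d \<ge> 2"
  shows "inj_on (lift_arc (d * m) m) (arcs (d \<ge> 3) {0..<int m} \<times> {0..<d})"
proof (rule inj_onI, clarify)
  fix a b c e i k
  assume p: "(a, b) \<in> arcs (d \<ge> 3) {0..<int m}" and q: "(c, e) \<in> arcs (d \<ge> 3) {0..<int m}"
    and i: "i \<in> {0..<d}" and k: "k \<in> {0..<d}"
    and eq: "lift_arc (d * m) m ((a, b), i) = lift_arc (d * m) m ((c, e), k)"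
  let ?n = "int (d * m)"
  define l l' where "l = arc_len (int m) a b" and "l' = arc_len (int m) c e"
  note P = lift_arc_props[OF d p, simplified, folded l_def] and Q = lift_arc_props[OF d q, simplified, folded l'_def]
  have eq': "chord ?n (a + int i * int m) l = chord ?n (c + int k * int m) l'"
    using eq by (simp add: lift_arc_def l_def l'_def)
  have *: "(a + int i * int m) mod ?n = (c + int k * int m) mod ?n" "l = l'"
    using chord_eqD[OF eq'] P Q by auto
  have ac: "0 \<le> a" "a < int m" "0 \<le> c" "c < int m" using p q by (auto simp: arcs_def)
  have bound: "0 \<le> a + int i * int m \<and> a + int i * int m < ?n" if "0 \<le> a" "a < int m" "i < d" for a i
  proof -
    have "int (i + 1) * int m \<le> int d * int m" using that by (intro mult_right_mono) auto
    thus ?thesis using that by (simp add: algebra_simps)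
  qed
  have eq2: "a + int i * int m = c + int k * int m"
    using * bound[of a i] bound[of c k] ac i k by simp
  hence "(a + int i * int m) mod int m = (c + int k * int m) mod int m" by simp
  hence "a = c" using ac by simp
  moreover from this have "i = k" using eq2 ac by simp
  moreover have "b = e" using P(5) Q(5) *(2) \<open>a = c\<close> by simp
  ultimately show "(a, b) = (c, e) \<and> i = k" by simp
qed

text \<open>A shift by \<open>t\<close> multiples of \<open>m\<close> is a move by
  \<open>t mod d\<close> sectors followed by \<open>t div d\<close> full turns, so the crossing
  condition modulo \<open>m\<close> is the one modulo \<open>d * m\<close> quantified over
  sectors.\<close>

lemma crossing_lift_arc:
  assumes d: "d \<ge> 2" and p: "p \<in> arcs (d \<ge> 3) {0..<int m}" and q: "q \<in> arcs (d \<ge> 3) {0..<int m}"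
  shows "arc_cross p q \<longleftrightarrow> (\<exists>i<d. \<exists>k<d. crossing (lift_arc (d * m) m (p, i)) (lift_arc (d * m) m (q, k)))"
proof -
  define l l' where "l = arc_len (int m) (fst p) (snd p)" and "l' = arc_len (int m) (fst q) (snd q)"
  note P = lift_arc_props[OF d p, folded l_def] and Q = lift_arc_props[OF d q, folded l'_def]
  have A: "arc_cross p q \<longleftrightarrow> (\<exists>t. int_cross (fst p) l (fst q + t * int m) l')"
    using P Q by (subst P(5), subst Q(5), intro arc_cross_mod_iff) auto
  have C: "crossing (lift_arc (d * m) m (p, i)) (lift_arc (d * m) m (q, k)) \<longleftrightarrow>
      (\<exists>t. int_cross (fst p + int i * int m) l (fst q + int k * int m + t * int (d * m)) l')" for i k
    unfolding lift_arc_def fst_conv snd_conv l_def[symmetric] l'_def[symmetric]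
    using P Q by (intro crossing_chord_iff) auto
  show ?thesis
  proof
    assume "arc_cross p q"
    then obtain t where t: "int_cross (fst p) l (fst q + t * int m) l'" using A by blast
    define k where "k = nat (t mod int d)"
    have k: "int k = t mod int d" "k < d" using d by (auto simp: k_def nat_less_iff)
    have "t * int m = (int k + (t div int d) * int d) * int m" unfolding k by simp
    hence "int_cross (fst p + int 0 * int m) l (fst q + int k * int m + (t div int d) * int (d * m)) l'"
      using t by (simp add: algebra_simps)
    hence "crossing (lift_arc (d * m) m (p, 0)) (lift_arc (d * m) m (q, k))"
      using C by blast
    thus "\<exists>i<d. \<exists>k<d. crossing (lift_arc (d * m) m (p, i)) (lift_arc (d * m) m (q, k))"
      using k d by (intro exI[of _ 0] conjI exI[of _ k]) auto
  next
    assume "\<exists>i<d. \<exists>k<d. crossing (lift_arc (d * m) m (p, i)) (lift_arc (d * m) m (q, k))"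
    then obtain i k t where
      "int_cross (fst p + int i * int m) l (fst q + int k * int m + t * int (d * m)) l'"
      using C by blast
    hence "int_cross (fst p + int i * int m) l
             (fst q + (int k + t * int d - int i) * int m + int i * int m) l'"
      by (simp add: algebra_simps)
    thus "arc_cross p q" using A int_cross_translate by blast
  qed
qed

lemma noncrossing_lift_family:
  assumes d: "d \<ge> 2" and A: "A \<subseteq> arcs (d \<ge> 3) {0..<int m}"
  shows "noncrossing (lift_family d m A) \<longleftrightarrow> A \<in> arc_families (d \<ge> 3) {0..<int m}"
proof -
  have "A \<in> arc_families (d \<ge> 3) {0..<int m} \<longleftrightarrow> (\<forall>p\<in>A. \<forall>q\<in>A. \<not> arc_cross p q)"
    using A by (simp add: arc_families_def)
  also have "\<dots> \<longleftrightarrow> (\<forall>p\<in>A. \<forall>q\<in>A. \<forall>i<d. \<forall>k<d. 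
      \<not> crossing (lift_arc (d * m) m (p, i)) (lift_arc (d * m) m (q, k)))"
    using A crossing_lift_arc[OF d] by (meson subsetD)
  also have "\<dots> \<longleftrightarrow> noncrossing (lift_family d m A)"
    unfolding noncrossing_def lift_family_def by (auto simp: Ball_def)
  finally show ?thesis by simp
qed

lemma lift_arc_in_diagonals:
  assumes d: "d \<ge> 2" and p: "p \<in> arcs (d \<ge> 3) {0..<int m}"
  shows "lift_arc (d * m) m (p, i) \<in> diagonals (d * m)"
  unfolding lift_arc_def using lift_arc_props[OF d p] by (intro chord_in_diagonals) auto

text \<open>Rotation by \<open>m\<close> carries each sector to the next; the last one returns to
  sector 0 after a full turn, which \<open>chord\<close> does not see.\<close>

lemma rot_lift_family:
  assumes "d \<ge> 2"
  shows "rot (d * m) (int m) (lift_family d m A) = lift_family d m A"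
proof -
  have r: "(\<lambda>v. (v + int m) mod int (d * m)) ` lift_arc (d * m) m (p, i) =
           lift_arc (d * m) m (p, Suc i mod d)" for p i
  proof -
    have "Suc i * m = (Suc i mod d + Suc i div d * d) * m" by simp
    hence "int (Suc i * m) = int ((Suc i mod d + Suc i div d * d) * m)" by (simp only:)
    hence "int i * int m + int m = int (Suc i mod d) * int m + int (Suc i div d) * int (d * m)"
      by (simp only: of_nat_mult of_nat_add of_nat_Suc algebra_simps mult_1_left mult_1_right)
    hence "fst p + int i * int m + int m =
        fst p + int (Suc i mod d) * int m + int (Suc i div d) * int (d * m)"
      by (simp only: add.assoc)
    thus ?thesis
      unfolding lift_arc_def fst_conv snd_conv rotate_chord by (simp only: chord_shift)
  qed
  show ?thesis
  proof (intro equalityI subsetI)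
    fix x assume "x \<in> rot (d * m) (int m) (lift_family d m A)"
    then obtain p i where "p \<in> A" "i < d" "x = lift_arc (d * m) m (p, Suc i mod d)"
      unfolding rot_def lift_family_def image_image using r by force
    thus "x \<in> lift_family d m A" using assms by (auto simp: lift_family_def)
  next
    fix x assume "x \<in> lift_family d m A"
    then obtain p i where pi: "p \<in> A" "i < d" "x = lift_arc (d * m) m (p, i)"
      by (auto simp: lift_family_def)
    obtain k where k: "k < d" "Suc k mod d = i"
    proof (cases i)
      case 0
      thus ?thesis using that[of "d - 1"] assms by simp
    next
      case (Suc j)
      thus ?thesis using that[of j] pi by simp
    qed
    have "x = (\<lambda>v. (v + int m) mod int (d * m)) ` lift_arc (d * m) m (p, k)"
      using r k pi by simp
    thus "x \<in> rot (d * m) (int m) (lift_family d m A)"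
      using pi k unfolding rot_def lift_family_def by auto
  qed
qed

lemma lift_family_periodic:
  assumes d: "d \<ge> 2" and A: "A \<in> arc_families (d \<ge> 3) {0..<int m}"
  shows "lift_family d m A \<in> periodic_dissections d m"
proof -
  have sub: "A \<subseteq> arcs (d \<ge> 3) {0..<int m}" using A by (simp add: arc_families_def)
  have "chord (int (d * m)) x (int m) \<notin> lift_family d m A" if "d = 2" for x
  proof
    assume "chord (int (d * m)) x (int m) \<in> lift_family d m A"
    then obtain p i where p: "p \<in> A" and e: "chord (int (d * m)) x (int m) = lift_arc (d * m) m (p, i)"
      by (auto simp: lift_family_def)
    note P = lift_arc_props[OF d subsetD[OF sub p]]
    from chord_eqD(2)[OF e[unfolded lift_arc_def]] P that show False by simp
  qed
  thus ?thesis
    using noncrossing_lift_family[OF d sub] A rot_lift_family[OF d] lift_arc_in_diagonals[OF d] sub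
    by (auto simp: periodic_dissections_def lift_family_def)
qed

lemma periodic_diagonal_lift:
  assumes d: "d \<ge> 2" and D: "D \<in> periodic_dissections d m" and \<delta>: "\<delta> \<in> D"
  obtains p i where "p \<in> arcs (d \<ge> 3) {0..<int m}" "i < d" "\<delta> = lift_arc (d * m) m (p, i)"
proof -
  let ?n = "int (d * m)"
  have "\<delta> \<in> diagonals (d * m)" using D \<delta> by (auto simp: periodic_dissections_def)
  then obtain x l where \<delta>': "\<delta> = chord ?n x l" "2 \<le> l" "2 * l \<le> ?n"
    by (rule diagonals_chordE)
  have n: "?n > 0" using \<delta>' by linarith
  hence m: "m > 0" by (cases m) auto
  \<comment> \<open>A diagonal whose shorter side is longer than \<open>m\<close> would cross its
    own image under rotation by \<open>m\<close>, which also belongs to \<open>D\<close>.\<close>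
  have "l \<le> int m"
  proof (rule ccontr)
    assume "\<not> l \<le> int m"
    hence "int_cross x l (x + int m + 0 * ?n) l" using m by (simp add: int_cross_def)
    hence "\<exists>t. int_cross x l (x + int m + t * ?n) l" by blast
    hence "crossing \<delta> (chord ?n (x + int m) l)"
      unfolding \<delta>'(1) using \<delta>'(2,3) by (subst crossing_chord_iff) (linarith | assumption)+
    moreover have "chord ?n (x + int m) l \<in> D"
      using rot_memD[of "d * m" "int m" D x l 1] D \<delta> \<delta>' by (simp add: periodic_dissections_def)
    ultimately show False using D \<delta> by (auto simp: periodic_dissections_def noncrossing_def)
  qed
  \<comment> \<open>For \<open>d = 2\<close> a chord of length \<open>m\<close> is a diameter, which
    \<open>periodic_dissections\<close> rules out.\<close>
  have loop: "d \<ge> 3" if "l = int m"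
    using D \<delta> \<delta>' that d by (cases "d = 2") (auto simp: periodic_dissections_def)
  define p where "p = (x mod int m, (x + l) mod int m)"
  define i where "i = nat ((x mod ?n) div int m)"
  have p: "p \<in> arcs (d \<ge> 3) {0..<int m}"
    unfolding p_def using \<delta>' \<open>l \<le> int m\<close> loop by (intro mod_pair_in_arcs) auto
  have x: "0 \<le> x mod ?n" "x mod ?n < ?n" using n by auto
  have i: "int i = (x mod ?n) div int m" using x by (simp add: i_def pos_imp_zdiv_nonneg_iff m)
  have "(x mod ?n) div int m * int m = x mod ?n - x mod ?n mod int m"
    by (simp add: minus_mod_eq_div_mult)
  hence "(x mod ?n) div int m * int m < int d * int m"
    using x m pos_mod_sign[of "int m" "x mod ?n"] unfolding of_nat_mult by linarith
  hence "(x mod ?n) div int m < int d" using m by simp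
  hence "i < d" using i by linarith
  have "x mod int m = (x mod ?n) mod int m" by (simp add: mod_mod_cancel)
  hence "fst p + int i * int m = x mod ?n" unfolding i p_def by simp
  moreover have "arc_len (int m) (fst p) (snd p) = l"
    unfolding p_def using \<delta>' \<open>l \<le> int m\<close> by (simp add: arc_len_mod)
  ultimately have "lift_arc (d * m) m (p, i) = chord ?n (x mod ?n) l"
    unfolding lift_arc_def fst_conv snd_conv by (simp only:)
  hence "\<delta> = lift_arc (d * m) m (p, i)" using \<delta>' by (simp only: chord_mod)
  with p \<open>i < d\<close> that show ?thesis by blast
qed

lemma periodic_dissection_is_lift:
  assumes d: "d \<ge> 2" and D: "D \<in> periodic_dissections d m"
  shows "D \<in> lift_family d m ` arc_families (d \<ge> 3) {0..<int m}"
proof -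
  let ?n = "int (d * m)"
  \<comment> \<open>By invariance under rotation, sector 0 already decides which arcs occur.\<close>
  define A where "A = {p \<in> arcs (d \<ge> 3) {0..<int m}. lift_arc (d * m) m (p, 0) \<in> D}"
  have rotD: "rot (d * m) (int m) D = D" using D by (simp add: periodic_dissections_def)
  have inv: "lift_arc (d * m) m (p, i) \<in> D \<longleftrightarrow> lift_arc (d * m) m (p, 0) \<in> D" if "i < d" for p i
  proof
    assume "lift_arc (d * m) m (p, 0) \<in> D"
    thus "lift_arc (d * m) m (p, i) \<in> D"
      using rot_memD[OF rotD, of "fst p" _ i] by (simp add: lift_arc_def)
  next
    assume "lift_arc (d * m) m (p, i) \<in> D"
    \<comment> \<open>Another \<open>d - i\<close> rotations complete a full turn and bring sector
      \<open>i\<close> back to sector 0.\<close>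
    from rot_memD[OF rotD this[unfolded lift_arc_def], of "d - i"]
    have "chord ?n (fst p + (int i * int m + int (d - i) * int m)) (arc_len (int m) (fst p) (snd p)) \<in> D"
      by (simp add: add.assoc)
    moreover have "int i * int m + int (d - i) * int m = 1 * ?n"
      using that by (simp add: distrib_right[symmetric])
    ultimately show "lift_arc (d * m) m (p, 0) \<in> D"
      using chord_shift[of ?n "fst p" 1] by (simp add: lift_arc_def)
  qed
  have "D = lift_family d m A"
  proof (intro equalityI subsetI)
    fix x assume "x \<in> D"
    then obtain p i where "p \<in> arcs (d \<ge> 3) {0..<int m}" "i < d" "x = lift_arc (d * m) m (p, i)"
      using periodic_diagonal_lift[OF d D] by metis
    thus "x \<in> lift_family d m A" using inv[of i p] \<open>x \<in> D\<close> by (auto simp: lift_family_def A_def)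
  next
    fix x assume "x \<in> lift_family d m A"
    then obtain p i where "p \<in> A" "i < d" "x = lift_arc (d * m) m (p, i)"
      by (auto simp: lift_family_def)
    thus "x \<in> D" using inv[of i p] by (simp add: A_def)
  qed
  moreover from this have "A \<in> arc_families (d \<ge> 3) {0..<int m}"
    using noncrossing_lift_family[OF d, of A m] D by (auto simp: A_def periodic_dissections_def)
  ultimately show ?thesis by blast
qed

lemma card_lift_family:
  assumes d: "d \<ge> 2" and A: "A \<subseteq> arcs (d \<ge> 3) {0..<int m}"
  shows "card (lift_family d m A) = d * card A"
proof -
  have "inj_on (lift_arc (d * m) m) (A \<times> {0..<d})"
    using inj_on_lift_arc[OF d] by (rule inj_on_subset) (use A in auto)
  thus ?thesis by (simp add: lift_family_def card_image card_cartesian_product)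
qed

lemma inj_on_lift_family:
  assumes d: "d \<ge> 2"
  shows "inj_on (lift_family d m) (arc_families (d \<ge> 3) {0..<int m})"
proof (rule inj_onI)
  fix A B assume AB: "A \<in> arc_families (d \<ge> 3) {0..<int m}" "B \<in> arc_families (d \<ge> 3) {0..<int m}"
    and eq: "lift_family d m A = lift_family d m B"
  have sub: "A \<times> {0..<d} \<subseteq> arcs (d \<ge> 3) {0..<int m} \<times> {0..<d}"
    "B \<times> {0..<d} \<subseteq> arcs (d \<ge> 3) {0..<int m} \<times> {0..<d}"
    using AB by (simp_all add: arc_families_def Sigma_mono)
  have "A \<times> {0..<d} = B \<times> {0..<d}"
    using inj_on_image_eq_iff[OF inj_on_lift_arc[OF d, of m] sub] eq by (simp add: lift_family_def)
  thus "A = B" using d by (auto simp: times_eq_iff)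
qed

lemma periodic_dissections_card:
  assumes d: "d \<ge> 2" and m: "(if d \<ge> 3 then 1 else 2) \<le> m"
  shows "card {D \<in> periodic_dissections d m. card D = d * j} =
           ((m - (if d \<ge> 3 then 1 else 2)) choose j) * ((m + j - 1) choose j)"
    and "D \<in> periodic_dissections d m \<Longrightarrow> d dvd card D"
proof -
  have all: "periodic_dissections d m = lift_family d m ` arc_families (d \<ge> 3) {0..<int m}"
    using lift_family_periodic[OF d] periodic_dissection_is_lift[OF d] by blast
  have card: "card (lift_family d m A) = d * card A" if "A \<in> arc_families (d \<ge> 3) {0..<int m}" for A
    using card_lift_family[OF d] that by (simp add: arc_families_def)
  have "{D \<in> periodic_dissections d m. card D = d * j} =
        lift_family d m ` {A \<in> arc_families (d \<ge> 3) {0..<int m}. card A = j}"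
    using d card by (auto simp: all)
  also have "card \<dots> = card {A \<in> arc_families (d \<ge> 3) {0..<int m}. card A = j}"
    by (intro card_image inj_on_subset[OF inj_on_lift_family[OF d]]) auto
  also have "\<dots> = ((m - (if d \<ge> 3 then 1 else 2)) choose j) * ((m + j - 1) choose j)"
    using card_arc_families[of "{0..<int m}" "d \<ge> 3" j] m by simp
  finally show "card {D \<in> periodic_dissections d m. card D = d * j} =
           ((m - (if d \<ge> 3 then 1 else 2)) choose j) * ((m + j - 1) choose j)" .
  show "d dvd card D" if "D \<in> periodic_dissections d m"
    using that card by (auto simp: all)
qed

section \<open>The number of all dissections\<close>

definition rotate_arc :: "int \<Rightarrow> int \<Rightarrow> int \<times> int \<Rightarrow> int \<times> int" where
  "rotate_arc m v p = ((fst p + v) mod m, (snd p + v) mod m)"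

lemma rotate_arc_mod: "rotate_arc m v (x mod m, (x + l) mod m) = ((x + v) mod m, (x + v + l) mod m)"
proof -
  have "(x + l + v) mod m = (x + v + l) mod m" by (simp add: ac_simps)
  thus ?thesis by (simp add: rotate_arc_def mod_add_left_eq)
qed

lemma arcs_modE:
  assumes "p \<in> arcs L {0..<m}"
  obtains x l where "p = (x mod m, (x + l) mod m)" "2 \<le> l" "l \<le> m"
proof -
  obtain a b where ab: "p = (a, b)" "0 \<le> a" "a < m" "0 \<le> b" "b < m"
    using assms by (auto simp: arcs_def)
  have "p = (a mod m, (a + arc_len m a b) mod m)" using ab by (simp add: arc_len_bounds)
  moreover have "2 \<le> arc_len m a b" using arc_len_ge_2 assms ab(1) by blast
  moreover have "arc_len m a b \<le> m" using arc_len_bounds ab by blast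
  ultimately show ?thesis by (rule that)
qed

lemma rotate_arc_in_arcs:
  assumes "p \<in> arcs True {0..<m}"
  shows "rotate_arc m v p \<in> arcs True {0..<m}"
  using assms by (elim arcs_modE) (simp add: rotate_arc_mod mod_pair_in_arcs)

lemma arc_cross_rotate_arc:
  assumes "p \<in> arcs True {0..<m}" "q \<in> arcs True {0..<m}"
  shows "arc_cross (rotate_arc m v p) (rotate_arc m v q) \<longleftrightarrow> arc_cross p q"
proof -
  obtain x l where p: "p = (x mod m, (x + l) mod m)" "2 \<le> l" "l \<le> m"
    using assms(1) by (rule arcs_modE)
  obtain y k where q: "q = (y mod m, (y + k) mod m)" "2 \<le> k" "k \<le> m"
    using assms(2) by (rule arcs_modE)
  have bounds: "1 \<le> l" "l \<le> m" "1 \<le> k" "k \<le> m" using p q by simp_all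
  have "int_cross (x + v) l (y + v + t * m) k \<longleftrightarrow> int_cross x l (y + t * m) k" for t
    using int_cross_translate[of x v l "y + t * m" k] by (simp add: ac_simps)
  thus ?thesis
    unfolding p(1) q(1) rotate_arc_mod arc_cross_mod_iff[OF bounds] by simp
qed

lemma rotate_arc_inverse:
  assumes "p \<in> arcs True {0..<m}"
  shows "rotate_arc m (- v) (rotate_arc m v p) = p"
  using assms by (elim arcs_modE) (simp add: rotate_arc_mod)

lemma rotate_arc_family:
  assumes "A \<in> arc_families True {0..<m}"
  shows "rotate_arc m v ` A \<in> arc_families True {0..<m}"
    "rotate_arc m (- v) ` rotate_arc m v ` A = A"
    "card (rotate_arc m v ` A) = card A"
proof -
  have A: "p \<in> arcs True {0..<m}" if "p \<in> A" for p
    using assms that by (auto simp: arc_families_def)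
  show "rotate_arc m v ` A \<in> arc_families True {0..<m}"
    using assms A rotate_arc_in_arcs arc_cross_rotate_arc unfolding arc_families_def by blast
  show "rotate_arc m (- v) ` rotate_arc m v ` A = A"
    using A by (simp add: image_image rotate_arc_inverse)
  have "inj_on (rotate_arc m v) A"
    using A by (intro inj_on_inverseI[of _ "rotate_arc m (- v)"]) (simp add: rotate_arc_inverse)
  thus "card (rotate_arc m v ` A) = card A" by (rule card_image)
qed

lemma card_loop_families_rotate:
  fixes m v :: int
  assumes "0 \<le> v" "v < m"
  shows "card {A \<in> arc_families True {0..<m}. (v, v) \<in> A \<and> card A = j} =
         card {A \<in> arc_families True {0..<m}. (0, 0) \<in> A \<and> card A = j}" (is "card ?F = card ?G")
proof -
  have "rotate_arc m v ` A \<in> ?F" if "A \<in> ?G" for A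
  proof -
    have "rotate_arc m v (0, 0) \<in> rotate_arc m v ` A" using that by blast
    hence "(v, v) \<in> rotate_arc m v ` A" using assms by (simp add: rotate_arc_def)
    thus ?thesis using that rotate_arc_family by simp
  qed
  moreover have "rotate_arc m (- v) ` A \<in> ?G" if "A \<in> ?F" for A
  proof -
    have "rotate_arc m (- v) (v, v) \<in> rotate_arc m (- v) ` A" using that by blast
    hence "(0, 0) \<in> rotate_arc m (- v) ` A" by (simp add: rotate_arc_def)
    thus ?thesis using that rotate_arc_family by simp
  qed
  moreover have "rotate_arc m v ` rotate_arc m (- v) ` A = A" if "A \<in> ?F" for A
    using rotate_arc_family(2)[of A m "- v"] that by simp
  ultimately have "bij_betw ((`) (rotate_arc m v)) ?G ?F"
    using rotate_arc_family(2)[of _ m v]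
    by (intro bij_betw_byWitness[of _ "(`) (rotate_arc m (- v))"]) auto
  thus ?thesis by (simp add: bij_betw_same_card)
qed

text \<open>Loops at different points cross, so a family contains at most one; by rotation its
  \<open>m\<close> possible positions contribute equally.\<close>

lemma card_families_split_loop:
  fixes m :: nat
  shows "card {A \<in> arc_families True {0..<int m}. card A = j} =
         card {A \<in> arc_families False {0..<int m}. card A = j} +
         m * card {A \<in> arc_families True {0..<int m}. (0, 0) \<in> A \<and> card A = j}"
proof -
  let ?V = "{0..<int m}"
  let ?F = "\<lambda>v. {A \<in> arc_families True ?V. (v, v) \<in> A \<and> card A = j}"
  let ?N = "{A \<in> arc_families False ?V. card A = j}"
  have "arcs False ?V = {p \<in> arcs True ?V. fst p \<noteq> snd p}" by (auto simp: arcs_def)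
  hence N: "A \<in> arc_families False ?V \<longleftrightarrow> A \<in> arc_families True ?V \<and> (\<forall>v. (v, v) \<notin> A)" for A
    by (fastforce simp: arc_families_def)
  have loopV: "v \<in> ?V" if "A \<in> arc_families True ?V" "(v, v) \<in> A" for A v
    using arc_familyD(1)[OF that] .
  have eq: "{A \<in> arc_families True ?V. card A = j} = ?N \<union> (\<Union>v\<in>?V. ?F v)"
    using N loopV by blast
  have fin: "finite (arc_families True ?V)" "finite ?N"
    using finite_arc_families[of ?V] by auto
  have "?F v \<inter> ?F w = {}" if "v \<noteq> w" for v w
  proof -
    have "arc_cross (v, v) (w, w)" using that by (auto simp: arc_cross_def cyc_between_def)
    thus ?thesis unfolding arc_families_def by blast
  qed
  hence U: "card (\<Union>v\<in>?V. ?F v) = (\<Sum>v\<in>?V. card (?F v))"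
    using fin by (intro card_UN_disjoint) auto
  also have "\<dots> = (\<Sum>v\<in>?V. card (?F 0))"
    by (rule sum.cong) (simp_all only: card_loop_families_rotate atLeastLessThan_iff)
  also have "\<dots> = m * card (?F 0)" by simp
  finally have U: "card (\<Union>v\<in>?V. ?F v) = m * card (?F 0)" .
  have "?N \<inter> (\<Union>v\<in>?V. ?F v) = {}" using N by blast
  thus ?thesis unfolding eq using fin U by (subst card_Un_disjoint) auto
qed

text \<open>
  A loop at \<open>0\<close> separates the other arcs from the puncture; cutting the vertex \<open>0\<close> into \<open>0\<close> and \<open>m\<close>
  makes them diagonals of an \<open>(m + 1)\<close>-gon.
\<close>

definition unroll_arc :: "int \<Rightarrow> int \<times> int \<Rightarrow> int set" where
  "unroll_arc m p = {fst p, if snd p = 0 then m else snd p}"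

text \<open>The end 0 is read as \<open>m\<close>, so these are the inequalities for diagonals of
  the \<open>(m + 1)\<close>-gon. The excluded pair \<open>(0, 0)\<close> corresponds to its closing
  edge from 0 to \<open>m\<close>.\<close>

definition loop_compatible :: "int \<Rightarrow> (int \<times> int) set" where
  "loop_compatible m = {p. fst p \<in> {0..<m} \<and> snd p \<in> {0..<m} \<and> p \<noteq> (0, 0) \<and>
     (snd p = 0 \<and> fst p + 1 < m \<or> fst p + 1 < snd p)}"

lemma loop_compatible_eq:
  "loop_compatible m = {p \<in> arcs True {0..<m}. p \<noteq> (0, 0) \<and> 0 \<notin> cyc_between (fst p) (snd p)}"
proof (intro equalityI subsetI)
  fix p assume "p \<in> loop_compatible m"
  then obtain a b where p: "p = (a, b)" "0 \<le> a" "a < m" "0 \<le> b" "b < m" "(a, b) \<noteq> (0, 0)"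
    "b = 0 \<and> a + 1 < m \<or> a + 1 < b" by (cases p) (auto simp: loop_compatible_def)
  hence "a + 1 \<in> {0..<m} \<inter> cyc_between a b" by (auto simp: cyc_between_def)
  hence "{0..<m} \<inter> cyc_between a b \<noteq> {}" by blast
  moreover have "0 \<notin> cyc_between a b" using p by (auto simp: cyc_between_def)
  ultimately show "p \<in> {p \<in> arcs True {0..<m}. p \<noteq> (0, 0) \<and> 0 \<notin> cyc_between (fst p) (snd p)}"
    using p by (simp add: arcs_def)
next
  fix p assume p: "p \<in> {p \<in> arcs True {0..<m}. p \<noteq> (0, 0) \<and> 0 \<notin> cyc_between (fst p) (snd p)}"
  then obtain a b where ab: "p = (a, b)" "0 \<le> a" "a < m" "0 \<le> b" "b < m" "(a, b) \<noteq> (0, 0)"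
    "0 \<notin> cyc_between a b" by (cases p) (auto simp: arcs_def)
  obtain c where "0 \<le> c" "c < m" "c \<in> cyc_between a b"
    using p ab(1) by (auto simp: arcs_def)
  with ab show "p \<in> loop_compatible m"
    by (auto simp: loop_compatible_def cyc_between_def split: if_splits)
qed

lemma bij_betw_unroll_arc: "bij_betw (unroll_arc (int m)) (loop_compatible (int m)) (diagonals (Suc m))"
proof (rule bij_betwI')
  fix p q assume "p \<in> loop_compatible (int m)" "q \<in> loop_compatible (int m)"
  thus "unroll_arc (int m) p = unroll_arc (int m) q \<longleftrightarrow> p = q"
    by (cases p; cases q) (auto simp: loop_compatible_def unroll_arc_def doubleton_eq_iff split: if_splits)
next
  fix p assume "p \<in> loop_compatible (int m)"
  thus "unroll_arc (int m) p \<in> diagonals (Suc m)"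
    unfolding diagonals_def unroll_arc_def
    by (intro CollectI exI[of _ "fst p"] exI[of _ "if snd p = 0 then int m else snd p"])
       (cases p; auto simp: loop_compatible_def)
next
  fix \<delta> assume "\<delta> \<in> diagonals (Suc m)"
  then obtain i j where "\<delta> = {i, j}" "0 \<le> i" "i + 1 < j" "j \<le> int m" "\<not> (i = 0 \<and> j = int m)"
    by (auto simp: diagonals_def)
  thus "\<exists>p\<in>loop_compatible (int m). \<delta> = unroll_arc (int m) p"
    by (intro bexI[of _ "(i, if j = int m then 0 else j)"])
       (auto simp: loop_compatible_def unroll_arc_def)
qed

lemma crossing_unroll_arc:
  assumes "p \<in> loop_compatible m" "q \<in> loop_compatible m"
  shows "crossing (unroll_arc m p) (unroll_arc m q) \<longleftrightarrow> arc_cross p q"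
proof -
  obtain a b c d where pq: "p = (a, b)" "q = (c, d)" by (cases p; cases q)
  define b' d' where "b' = (if b = 0 then m else b)" and "d' = (if d = 0 then m else d)"
  have lt: "a < b'" "c < d'" using assms pq by (auto simp: loop_compatible_def b'_def d'_def)
  have "crossing {a, b'} {c, d'} \<longleftrightarrow> a < c \<and> c < b' \<and> b' < d' \<or> c < a \<and> a < d' \<and> d' < b'"
    using lt by (subst crossing_iff_cyc_between) (auto simp: cyc_between_def)
  also have "\<dots> \<longleftrightarrow> arc_cross p q"
  proof -
    have "x \<in> cyc_between a b \<longleftrightarrow> a < x \<and> x < b'" "x \<in> cyc_between c d \<longleftrightarrow> c < x \<and> x < d'"
      if "0 \<le> x" "x < m" for x
      using assms that by (auto simp: pq loop_compatible_def b'_def d'_def cyc_between_def)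
    moreover have "b \<in> cyc_between c d \<longleftrightarrow> c < b' \<and> b' < d'" "d \<in> cyc_between a b \<longleftrightarrow> a < d' \<and> d' < b'"
      using assms by (auto simp: pq loop_compatible_def b'_def d'_def cyc_between_def)
    moreover have "0 \<le> a" "a < m" "0 \<le> c" "c < m"
      using assms by (auto simp: pq loop_compatible_def)
    ultimately show ?thesis by (auto simp: pq arc_cross_def)
  qed
  finally show ?thesis by (simp only: pq unroll_arc_def b'_def d'_def fst_conv snd_conv)
qed

lemma loop_families_eq:
  assumes "m \<ge> 2"
  shows "{A \<in> arc_families True {0..<m}. (0, 0) \<in> A} =
    insert (0, 0) ` {B. B \<subseteq> loop_compatible m \<and> (\<forall>p\<in>B. \<forall>q\<in>B. \<not> arc_cross p q)}" (is "?F = insert _ ` ?G")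
proof (intro equalityI subsetI)
  fix A assume "A \<in> ?F"
  hence A: "A \<subseteq> arcs True {0..<m}" "\<forall>p\<in>A. \<forall>q\<in>A. \<not> arc_cross p q" "(0, 0) \<in> A"
    by (auto simp: arc_families_def)
  \<comment> \<open>Passing over 0 means crossing the loop there.\<close>
  have "0 \<notin> cyc_between (fst p) (snd p)" if "p \<in> A" for p
  proof
    assume "0 \<in> cyc_between (fst p) (snd p)"
    hence "arc_cross (0, 0) p" by (auto simp: arc_cross_def cyc_between_def split: if_splits)
    thus False using A that by blast
  qed
  hence "A - {(0, 0)} \<in> ?G" using A by (auto simp: loop_compatible_eq)
  thus "A \<in> insert (0, 0) ` ?G" using A(3) by (intro image_eqI[of _ _ "A - {(0, 0)}"]) auto
next
  fix A assume "A \<in> insert (0, 0) ` ?G"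
  then obtain B where B: "A = insert (0, 0) B" "B \<subseteq> loop_compatible m" "\<forall>p\<in>B. \<forall>q\<in>B. \<not> arc_cross p q"
    by blast
  have "1 \<in> {0..<m} \<inter> cyc_between 0 0" using assms by (simp add: cyc_between_def)
  hence "{0..<m} \<inter> cyc_between 0 0 \<noteq> {}" by blast
  hence "(0, 0) \<in> arcs True {0..<m}" using assms by (simp add: arcs_def)
  moreover have "\<not> arc_cross (0, 0) p \<and> \<not> arc_cross p (0, 0)" if "p \<in> insert (0, 0) B" for p
  proof -
    have "0 \<notin> cyc_between (fst p) (snd p)"
      using that B(2) by (auto simp: loop_compatible_eq cyc_between_def)
    thus ?thesis by (simp add: arc_cross_def)
  qed
  ultimately show "A \<in> ?F"
    using B unfolding arc_families_def by (auto simp: loop_compatible_eq)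
qed

text \<open>The extra element in \<open>Suc k\<close> is the loop itself, which becomes the edge
  along which the polygon was cut open.\<close>

lemma card_loop_families:
  assumes "m \<ge> 2"
  shows "card {A \<in> arc_families True {0..<int m}. (0, 0) \<in> A \<and> card A = Suc k} =
         card (dissections (Suc m) k)"
proof -
  let ?X = "loop_compatible (int m)" and ?u = "unroll_arc (int m)"
  let ?G = "{B. B \<subseteq> ?X \<and> (\<forall>p\<in>B. \<forall>q\<in>B. \<not> arc_cross p q)}"
  let ?Gk = "{B. B \<subseteq> ?X \<and> (\<forall>p\<in>B. \<forall>q\<in>B. \<not> arc_cross p q) \<and> card B = k}"
  have finX: "finite ?X"
    using finite_arcs[of "{0..<int m}" True] by (simp add: loop_compatible_eq)
  have not0: "(0, 0) \<notin> B" if "B \<subseteq> ?X" for B using that by (auto simp: loop_compatible_def)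
  have "{A \<in> arc_families True {0..<int m}. (0, 0) \<in> A \<and> card A = Suc k} =
        {A \<in> arc_families True {0..<int m}. (0, 0) \<in> A} \<inter> {A. card A = Suc k}" by blast
  also have "\<dots> = insert (0, 0) ` ?Gk"
  proof -
    have c: "card (insert (0, 0) B) = Suc (card B)" if "B \<subseteq> ?X" for B
      using that not0 finite_subset[OF that finX] by simp
    have "A \<in> insert (0, 0) ` ?G \<inter> {A. card A = Suc k} \<longleftrightarrow> A \<in> insert (0, 0) ` ?Gk" for A
    proof -
      have "A \<in> insert (0, 0) ` ?G \<inter> {A. card A = Suc k} \<longleftrightarrow>
          (\<exists>B. A = insert (0, 0) B \<and> B \<in> ?G \<and> card (insert (0, 0) B) = Suc k)"
        by (simp only: image_iff Int_iff mem_Collect_eq Bex_def) blast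
      also have "\<dots> \<longleftrightarrow> (\<exists>B. A = insert (0, 0) B \<and> B \<in> ?G \<and> card B = k)"
      proof -
        have "B \<in> ?G \<and> card (insert (0, 0) B) = Suc k \<longleftrightarrow> B \<in> ?G \<and> card B = k" for B
          using c[of B] by (simp cong: conj_cong)
        thus ?thesis by (simp only:)
      qed
      finally show ?thesis by (simp only: image_iff mem_Collect_eq Bex_def) blast
    qed
    moreover have "int m \<ge> 2" using assms by simp
    ultimately show ?thesis by (simp only: loop_families_eq) blast
  qed
  also have "card \<dots> = card ?Gk"
    using not0 by (intro card_image inj_onI) (metis (no_types, lifting) insert_ident mem_Collect_eq)
  also have "\<dots> = card ((`) ?u ` ?Gk)"
  proof -
    have "inj_on ((`) ?u) (Pow ?X)"
      using bij_betw_unroll_arc by (intro inj_on_image_Pow) (auto simp: bij_betw_def)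
    moreover have "?Gk \<subseteq> Pow ?X" by blast
    ultimately show ?thesis by (metis (lifting) card_image inj_on_subset)
  qed
  also have "(`) ?u ` ?Gk = dissections (Suc m) k"
  proof (intro equalityI subsetI)
    have inj: "inj_on ?u ?X" and surj: "?u ` ?X = diagonals (Suc m)"
      using bij_betw_unroll_arc by (auto simp: bij_betw_def)
    have iff: "?u ` B \<in> dissections (Suc m) k \<longleftrightarrow> B \<in> ?Gk" if "B \<subseteq> ?X" for B
    proof -
      have "card (?u ` B) = card B" "finite (?u ` B)"
        using card_image[OF inj_on_subset[OF inj that]] finite_subset[OF that finX] by simp_all
      moreover have "(\<forall>p\<in>?u ` B. \<forall>q\<in>?u ` B. \<not> crossing p q) \<longleftrightarrow> (\<forall>p\<in>B. \<forall>q\<in>B. \<not> arc_cross p q)"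
      proof -
        have "crossing (?u p) (?u q) \<longleftrightarrow> arc_cross p q" if "p \<in> B" "q \<in> B" for p q
          using that \<open>B \<subseteq> ?X\<close> by (intro crossing_unroll_arc) auto
        thus ?thesis by simp
      qed
      moreover have "?u ` B \<subseteq> diagonals (Suc m)" using that surj by blast
      ultimately show ?thesis using that by (simp add: dissections_def conj_commute)
    qed
    show "D \<in> dissections (Suc m) k" if "D \<in> (`) ?u ` ?Gk" for D using that iff by blast
    show "D \<in> (`) ?u ` ?Gk" if "D \<in> dissections (Suc m) k" for D
    proof -
      have "D \<subseteq> ?u ` ?X" using that surj by (simp add: dissections_def)
      then obtain B where "B \<subseteq> ?X" "D = ?u ` B" by (auto simp: subset_image_iff)
      thus ?thesis using iff that by blast
    qed
  qed
  finally show ?thesis .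
qed

text \<open>The Kirkman-Cayley formula without division. For \<open>m = n - 1\<close> the counts
  with and without loops share their second factor, and by Pascal their first factors differ by
  \<open>(m - 2) choose k\<close>; what remains is \<open>m\<close> times the families with a loop
  at 0.\<close>

theorem card_dissections:
  assumes "n \<ge> 3"
  shows "(n - 1) * card (dissections n k) = ((n - 3) choose k) * ((n + k - 1) choose Suc k)"
proof -
  obtain m' where m': "n = Suc (Suc (Suc m'))"
    using assms that[of "n - 3"] by simp
  define m where "m = Suc (Suc m')"
  have card_V: "card {0..<int m} = m" and "m \<ge> 2" by (simp_all add: m_def)
  have "((m - 1) choose Suc k) * ((m + Suc k - 1) choose Suc k) =
        ((m - 2) choose Suc k) * ((m + Suc k - 1) choose Suc k) + m * card (dissections (Suc m) k)"
    using card_families_split_loop[of m "Suc k"] card_loop_families[OF \<open>m \<ge> 2\<close>, of k]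
      card_arc_families[of "{0..<int m}" True "Suc k", unfolded card_V]
      card_arc_families[of "{0..<int m}" False "Suc k", unfolded card_V] \<open>m \<ge> 2\<close>
    by simp
  thus ?thesis by (simp add: m' m_def distrib_right)
qed

section \<open>Burnside's lemma for rotations\<close>

lemma finite_diagonals: "finite (diagonals n)"
  by (rule finite_subset[of _ "(\<lambda>(i, j). {i, j}) ` ({0..<int n} \<times> {0..<int n})"])
     (auto simp: diagonals_def)

lemma dissections_iff:
  "D \<in> dissections n k \<longleftrightarrow> D \<subseteq> diagonals n \<and> noncrossing D \<and> card D = k"
  using finite_subset[OF _ finite_diagonals] by (auto simp: dissections_def noncrossing_def)

lemma finite_dissections: "finite (dissections n k)"
  by (rule finite_subset[of _ "Pow (diagonals n)"]) (auto simp: dissections_iff finite_diagonals)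

lemma rotate_diagonal:
  assumes "\<delta> \<in> diagonals n"
  shows "(\<lambda>v. (v + g) mod int n) ` \<delta> \<in> diagonals n"
  using assms by (elim diagonals_chordE) (simp add: rotate_chord chord_in_diagonals)

lemma rotate_diagonal_rotate:
  assumes "\<delta> \<in> diagonals n"
  shows "(\<lambda>v. (v + g) mod int n) ` (\<lambda>v. (v + h) mod int n) ` \<delta> = (\<lambda>v. (v + (g + h)) mod int n) ` \<delta>"
  using assms
proof (elim diagonals_chordE)
  fix x l assume "\<delta> = chord (int n) x l"
  moreover have "x + h + g = x + (g + h)" by simp
  ultimately show ?thesis by (simp only: rotate_chord)
qed

lemma rotate_diagonal_0:
  assumes "\<delta> \<in> diagonals n"
  shows "(\<lambda>v. (v + 0) mod int n) ` \<delta> = \<delta>"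
  using assms by (elim diagonals_chordE) (simp add: rotate_chord[where g = 0, simplified])

lemma crossing_rotate:
  assumes "\<delta> \<in> diagonals n" "\<epsilon> \<in> diagonals n"
  shows "crossing ((\<lambda>v. (v + g) mod int n) ` \<delta>) ((\<lambda>v. (v + g) mod int n) ` \<epsilon>) \<longleftrightarrow> crossing \<delta> \<epsilon>"
proof -
  obtain x l where \<delta>: "\<delta> = chord (int n) x l" "2 \<le> l" "2 * l \<le> int n"
    using assms(1) by (rule diagonals_chordE)
  obtain y k where \<epsilon>: "\<epsilon> = chord (int n) y k" "2 \<le> k" "2 * k \<le> int n"
    using assms(2) by (rule diagonals_chordE)
  have lk: "1 \<le> l" "1 \<le> k" "l + k \<le> int n" using \<delta> \<epsilon> by simp_all
  have "int_cross (x + g) l (y + g + t * int n) k \<longleftrightarrow> int_cross x l (y + t * int n) k" for t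
    using int_cross_translate[of x g l "y + t * int n" k] by (simp add: ac_simps)
  thus ?thesis
    unfolding \<delta>(1) \<epsilon>(1) rotate_chord crossing_chord_iff[OF lk] by simp
qed

lemma rot_rot: "D \<subseteq> diagonals n \<Longrightarrow> rot n g (rot n h D) = rot n (g + h) D"
  unfolding rot_def image_image[of _ "\<lambda>d. (\<lambda>v. (v + h) mod int n) ` d"]
  by (intro image_cong refl rotate_diagonal_rotate) auto

lemma rot_0: "D \<subseteq> diagonals n \<Longrightarrow> rot n 0 D = D"
  unfolding rot_def using rotate_diagonal_0 by (metis (no_types, lifting) image_cong image_ident subsetD)

lemma rot_mod: "rot n (g mod int n) D = rot n g D"
  by (simp add: rot_def mod_add_right_eq)

lemma inj_on_rotate: "inj_on (\<lambda>d. (\<lambda>v. (v + g) mod int n) ` d) (diagonals n)"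
proof (rule inj_on_inverseI)
  fix \<delta> assume "\<delta> \<in> diagonals n"
  thus "(\<lambda>d. (\<lambda>v. (v + (- g)) mod int n) ` d) ((\<lambda>v. (v + g) mod int n) ` \<delta>) = \<delta>"
    by (simp only: rotate_diagonal_rotate left_minus rotate_diagonal_0)
qed

lemma rot_dissections:
  assumes "D \<in> dissections n k"
  shows "rot n g D \<in> dissections n k"
proof -
  have D: "D \<subseteq> diagonals n" "noncrossing D" "card D = k" using assms by (auto simp: dissections_iff)
  have "card (rot n g D) = k"
    unfolding rot_def using D by (subst card_image) (auto intro: inj_on_subset[OF inj_on_rotate])
  moreover have "rot n g D \<subseteq> diagonals n" using D(1) rotate_diagonal by (auto simp: rot_def)
  moreover have "noncrossing (rot n g D)"
    unfolding noncrossing_def rot_def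
  proof (intro ballI, elim imageE)
    fix d e \<delta> \<epsilon> assume "d = (\<lambda>v. (v + g) mod int n) ` \<delta>" "\<delta> \<in> D" "e = (\<lambda>v. (v + g) mod int n) ` \<epsilon>" "\<epsilon> \<in> D"
    thus "\<not> crossing d e" using crossing_rotate[of \<delta> n \<epsilon> g] D by (auto simp: noncrossing_def)
  qed
  ultimately show ?thesis by (simp add: dissections_iff)
qed

lemma rotation_eq_rot: "D \<in> dissections n k \<Longrightarrow> rotation n k g D = rot n g D"
  by (simp add: rotation_def rot_def)

lemma rotation_group_action:
  assumes "n > 0"
  shows "group_action (integer_mod_group n) (dissections n k) (rotation n k)"
proof -
  let ?E = "dissections n k"
  have inv: "rot n (- g) (rot n g D) = D" "rot n g (rot n (- g) D) = D" if "D \<in> ?E" for g D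
    using that rot_rot[of D n] rot_0[of D n] by (simp_all add: dissections_iff)
  have bij: "rotation n k g \<in> Bij ?E" for g
  proof -
    have "bij_betw (rotation n k g) ?E ?E"
      using inv rot_dissections
      by (intro bij_betw_byWitness[of _ "rot n (- g)"]) (auto simp: rotation_eq_rot)
    thus ?thesis by (simp add: Bij_def rotation_def)
  qed
  have "rotation n k ((g + h) mod int n) = compose ?E (rotation n k g) (rotation n k h)" for g h
  proof
    fix D
    show "rotation n k ((g + h) mod int n) D = compose ?E (rotation n k g) (rotation n k h) D"
    proof (cases "D \<in> ?E")
      case True
      thus ?thesis
        by (simp add: compose_eq rotation_eq_rot rot_dissections rot_mod rot_rot dissections_iff[THEN iffD1])
    next
      case False
      thus ?thesis by (simp add: rotation_def compose_def)
    qed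
  qed
  hence "rotation n k \<in> hom (integer_mod_group n) (BijGroup ?E)"
    using bij by (auto simp: hom_def BijGroup_def)
  thus ?thesis
    by (simp add: group_action_def group_hom_def group_hom_axioms_def group_BijGroup)
qed

definition fixed_dissections :: "nat \<Rightarrow> nat \<Rightarrow> int \<Rightarrow> int set set set" where
  "fixed_dissections n k g = {D \<in> dissections n k. rot n g D = D}"

lemma burnside_dissection_classes:
  assumes "n > 0"
  shows "card (dissection_classes n k) * n = (\<Sum>g\<in>{0..<int n}. card (fixed_dissections n k g))"
proof -
  interpret group_action "integer_mod_group n" "dissections n k" "rotation n k"
    by (rule rotation_group_action[OF assms])
  have carrier: "carrier (integer_mod_group n) = {0..<int n}"
    using assms by (simp add: carrier_integer_mod_group)
  have "invariants (dissections n k) (rotation n k) g = fixed_dissections n k g" for g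
    unfolding invariants_def fixed_dissections_def
    by (intro Collect_cong conj_cong refl) (simp only: rotation_eq_rot)
  thus ?thesis
    using burnside[OF _ finite_dissections] by (simp add: dissection_classes_def carrier order_def)
qed

section \<open>Fixed points depend only on the order of the rotation\<close>

lemma rot_multiple:
  assumes "D \<subseteq> diagonals n" "rot n g D = D"
  shows "rot n (int t * g) D = D"
proof (induction t)
  case 0
  thus ?case using rot_0[OF assms(1)] by simp
next
  case (Suc t)
  have "rot n (int (Suc t) * g) D = rot n (g + int t * g) D" by (simp add: distrib_right)
  also have "\<dots> = rot n g (rot n (int t * g) D)" using rot_rot[OF assms(1)] by simp
  also have "\<dots> = D" using Suc assms(2) by simp
  finally show ?case .
qed

text \<open>By Bezout, \<open>g\<close> and \<open>gcd g n\<close> are multiples of each other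
  modulo \<open>n\<close>; they generate the same subgroup of the rotations and so fix the same
  dissections.\<close>

lemma fixed_dissections_gcd:
  assumes "g > 0"
  shows "fixed_dissections n k (int g) = fixed_dissections n k (int (gcd g n))"
proof -
  have "rot n (int g) D = D \<longleftrightarrow> rot n (int (gcd g n)) D = D" if D: "D \<subseteq> diagonals n" for D
  proof
    assume *: "rot n (int g) D = D"
    obtain x y where "g * x = n * y + gcd g n" using bezout_nat[of g n] assms by auto
    hence "int (g * x) = int (n * y + gcd g n)" by (simp only:)
    hence "(int x * int g) mod int n = int (gcd g n) mod int n" by (simp add: mult.commute)
    hence "rot n (int (gcd g n)) D = rot n (int x * int g) D" by (metis rot_mod)
    thus "rot n (int (gcd g n)) D = D" using rot_multiple[OF D *] by simp
  next
    assume *: "rot n (int (gcd g n)) D = D"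
    obtain t where "g = t * gcd g n" by (metis dvd_def gcd_dvd1 mult.commute)
    hence "int g = int t * int (gcd g n)" by (metis of_nat_mult)
    thus "rot n (int g) D = D" using rot_multiple[OF D *, of t] by simp
  qed
  thus ?thesis by (auto simp: fixed_dissections_def dissections_iff)
qed

lemma dissection_classes_totient_sum:
  assumes "n > 0"
  shows "card (dissection_classes n k) * n =
    (\<Sum>d | d dvd n. totient d * card (fixed_dissections n k (int (n div d))))"
proof -
  let ?f = "\<lambda>g. card (fixed_dissections n k g)"
  \<comment> \<open>The identity is represented by \<open>n\<close> in place of 0:
    \<open>fixed_dissections_gcd\<close> needs a positive rotation, and the totient count runs over
    \<open>{0<..n}\<close>.\<close>
  have "?f (int n) = ?f 0" using rot_mod[of n "int n"] by (simp add: fixed_dissections_def)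
  hence "?f (if g = n then 0 else int g) = ?f (int g)" for g by simp
  hence "(\<Sum>g\<in>{0<..n}. ?f (int g)) = (\<Sum>g\<in>{0<..n}. ?f (if g = n then 0 else int g))"
    by (simp only:)
  also have "\<dots> = (\<Sum>g\<in>{0..<int n}. ?f g)"
    using assms
    by (intro sum.reindex_bij_witness[of _ "\<lambda>g. if g = 0 then n else nat g"
          "\<lambda>g. if g = n then 0 else int g"]) (auto split: if_splits)
  finally have "(\<Sum>g\<in>{0..<int n}. ?f g) = (\<Sum>g\<in>{0<..n}. ?f (int g))" by (rule sym)
  also have "\<dots> = (\<Sum>g\<in>{0<..n}. ?f (int (gcd g n)))"
    by (intro sum.cong refl arg_cong[of _ _ card] fixed_dissections_gcd) simp
  \<comment> \<open>Rotations are grouped by \<open>e = gcd g n\<close>; those in one group have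
    order \<open>n div e\<close>, and there are \<open>totient (n div e)\<close> of them.\<close>
  also have "\<dots> = (\<Sum>e | e dvd n. \<Sum>g\<in>{g \<in> {0<..n}. gcd g n = e}. ?f (int (gcd g n)))"
    using assms by (intro sum.group[symmetric]) auto
  also have "\<dots> = (\<Sum>e | e dvd n. totient (n div e) * ?f (int e))"
    using card_gcd_eq_totient[OF assms] by (intro sum.cong refl) simp
  also have "\<dots> = (\<Sum>d | d dvd n. totient d * ?f (int (n div d)))"
    using assms by (intro sum.reindex_bij_witness[of _ "\<lambda>d. n div d" "\<lambda>d. n div d"]) auto
  finally show ?thesis by (simp add: burnside_dissection_classes[OF assms])
qed

lemma diameters_cross_or_eq:
  fixes m x y :: int
  assumes "m > 0"
  shows "crossing (chord (2 * m) x m) (chord (2 * m) y m) \<or> chord (2 * m) x m = chord (2 * m) y m"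
proof -
  \<comment> \<open>\<open>z\<close> is the representative of \<open>y\<close> in
    \<open>[x, x + 2m)\<close>, and its position relative to \<open>x + m\<close> decides the
    case.\<close>
  define t where "t = - ((y - x) div (2 * m))"
  define z where "z = y + t * (2 * m)"
  have "z - x = (y - x) mod (2 * m)"
    by (simp add: z_def t_def minus_div_mult_eq_mod[symmetric])
  hence z: "x \<le> z" "z < x + 2 * m" using assms by (smt (verit) pos_mod_bound pos_mod_sign)+
  have y: "chord (2 * m) y m = chord (2 * m) z m" unfolding z_def by (simp only: chord_shift)
  consider "z = x" | "z = x + m" | "x < z" "z < x + m" | "x + m < z" using z by linarith
  thus ?thesis
  proof cases
    case 1
    thus ?thesis using y by simp
  next
    case 2
    have "(x + m + m) mod (2 * m) = x mod (2 * m)"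
      using mod_add_self2[of x "2 * m"] by (simp add: add.assoc)
    thus ?thesis using y 2 by (auto simp: chord_def)
  next
    case 3
    hence "int_cross x m (z + 0 * (2 * m)) m" by (simp add: int_cross_def)
    hence "\<exists>t. int_cross x m (z + t * (2 * m)) m" by blast
    thus ?thesis unfolding y using assms by (subst crossing_chord_iff) auto
  next
    case 4
    \<comment> \<open>In the second half of the window it is the copy one turn back that overlaps
      the interval from \<open>x\<close>.\<close>
    hence "int_cross x m (z + (- 1) * (2 * m)) m" using z by (simp add: int_cross_def)
    hence "\<exists>t. int_cross x m (z + t * (2 * m)) m" by blast
    thus ?thesis unfolding y using assms by (subst crossing_chord_iff) auto
  qed
qed

lemma fixed_dissections_eq_periodic:
  assumes d: "d \<ge> 2" and m: "m \<ge> 2 \<or> d \<ge> 3" and k: "d = 2 \<Longrightarrow> even k"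
  shows "fixed_dissections (d * m) k (int m) = {D \<in> periodic_dissections d m. card D = k}"
proof (intro equalityI subsetI)
  fix D assume "D \<in> {D \<in> periodic_dissections d m. card D = k}"
  thus "D \<in> fixed_dissections (d * m) k (int m)"
    by (simp add: fixed_dissections_def periodic_dissections_def dissections_iff)
next
  fix D assume "D \<in> fixed_dissections (d * m) k (int m)"
  hence D: "D \<subseteq> diagonals (d * m)" "noncrossing D" "card D = k" "rot (d * m) (int m) D = D"
    by (auto simp: fixed_dissections_def dissections_iff)
  have "chord (int (d * m)) x (int m) \<notin> D" if "d = 2" for x
  proof
    assume inD: "chord (int (d * m)) x (int m) \<in> D"
    define \<delta> where "\<delta> = chord (2 * int m) x (int m)"
    have \<delta>: "\<delta> \<in> D" using inD that by (simp add: \<delta>_def)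
    have m: "m \<ge> 2" using m that by simp
    have fin: "finite D" using D(1) finite_diagonals finite_subset by blast
    have "(x + int m + int m) mod (2 * int m) = x mod (2 * int m)"
      using mod_add_self2[of x "2 * int m"] by (simp add: add.assoc)
    hence "chord (2 * int m) (x + int m) (int m) = \<delta>" by (auto simp: chord_def \<delta>_def)
    hence rot\<delta>: "(\<lambda>v. (v + int m) mod int (d * m)) ` \<delta> = \<delta>"
      using that by (simp add: \<delta>_def rotate_chord)
    \<comment> \<open>The unique diameter is its own orbit, so it would make the number of diagonals odd.\<close>
    have "rot (d * m) (int m) (D - {\<delta>}) = rot (d * m) (int m) D - rot (d * m) (int m) {\<delta>}"
      unfolding rot_def using inj_on_rotate by (rule inj_on_image_set_diff) (use D(1) \<delta> in auto)
    hence "rot (d * m) (int m) (D - {\<delta>}) = D - {\<delta>}"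
      using D(4) rot\<delta> by (simp add: rot_def)
    moreover have "chord (int (d * m)) y (int m) \<notin> D - {\<delta>}" for y
      using diameters_cross_or_eq[of "int m" x y] m that D(2) \<delta>
      by (auto simp: \<delta>_def noncrossing_def)
    ultimately have "D - {\<delta>} \<in> periodic_dissections d m"
      using D by (auto simp: periodic_dissections_def noncrossing_def)
    moreover have "(if d \<ge> 3 then 1 else 2) \<le> m" using m that by simp
    ultimately have "d dvd card (D - {\<delta>})" using periodic_dissections_card(2)[OF d] by blast
    moreover have "card D = Suc (card (D - {\<delta>}))" using card_Suc_Diff1[OF fin \<delta>] by simp
    ultimately show False using k that D(3) by simp
  qed
  thus "D \<in> {D \<in> periodic_dissections d m. card D = k}"
    using D by (simp add: periodic_dissections_def)
qed

section \<open>Evaluation for three missing diagonals\<close>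

lemma catalan_of_nat: "catalan (real m) = real ((2 * m) choose m) / (real m + 1)"
  by (simp add: catalan_def)

text \<open>Lets the convention that \<open>catalan\<close> vanishes off the naturals account for
  the rotations of order \<open>d\<close> that do not exist.\<close>

lemma catalan_divide_not_dvd:
  assumes "d > 0" "\<not> d dvd n"
  shows "catalan (real n / real d - real c) = 0"
proof -
  have "real n / real d - real c \<notin> \<nat>"
  proof
    assume "real n / real d - real c \<in> \<nat>"
    then obtain k where "real n / real d - real c = real k" by (auto simp: Nats_def)
    hence "real n = real ((k + c) * d)" using assms(1) by (simp add: field_simps)
    hence "n = (k + c) * d" by (simp only: of_nat_eq_iff)
    thus False using assms(2) by simp
  qed
  thus ?thesis by (simp add: catalan_def)
qed

lemma card_fixed_whole:
  assumes "n \<ge> 6"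
  shows "real (card (fixed_dissections n (n - 6) (int n))) =
    ((real n - 3) * (real n - 4)^2 * (real n - 5)) / (24 * (2 * real n - 5)) * catalan (real n - 2)"
proof -
  obtain N where N: "n = N + 6" using assms by (metis add.commute le_Suc_ex)
  have "rot n (int n) D = D" if "D \<in> dissections n k" for D k
    using that rot_mod[of n "int n" D] rot_0[of D n] by (simp add: dissections_iff)
  hence "fixed_dissections n (n - 6) (int n) = dissections n (n - 6)"
    by (auto simp: fixed_dissections_def)
  moreover have "(N + 5) * card (dissections n (n - 6)) = ((N + 3) choose N) * ((2 * N + 5) choose (N + 1))"
  proof -
    have "n - 1 = N + 5" "n - 3 = N + 3" "n + (n - 6) - 1 = 2 * N + 5" "Suc (n - 6) = N + 1" "n - 6 = N"
      using N by simp_all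
    thus ?thesis using card_dissections[of n "n - 6"] assms by (simp only:)
  qed
  hence "real ((N + 5) * card (dissections n (n - 6))) =
      real (((N + 3) choose N) * ((2 * N + 5) choose (N + 1)))" by (simp only:)
  hence "real (card (dissections n (n - 6))) =
      real ((N + 3) choose N) * real ((2 * N + 5) choose (N + 1)) / (real N + 5)"
    by (simp add: field_simps)
  moreover have "real ((N + 3) choose N) = (real N + 3) * (real N + 2) * (real N + 1) / 6"
  proof -
    have "real ((N + 3) choose N) = fact (N + 3) / (fact N * fact 3)"
      using binomial_fact[of N "N + 3", where 'a = real] by simp
    moreover have "fact (N + 3) = (real N + 3) * (real N + 2) * (real N + 1) * fact N"
      by (simp add: algebra_simps eval_nat_numeral)
    moreover have "fact 3 = (6 :: real)" by (simp add: eval_nat_numeral)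
    ultimately show ?thesis by simp
  qed
  \<comment> \<open>Passing to the central binomial of \<open>n - 2 = N + 4\<close> costs the
    quotient of \<open>(2N+8)(2N+7)(2N+6)\<close> by \<open>(N+4)(N+3)(N+2)\<close>, which is
    \<open>4(2N+7)/(N+2)\<close>. This is the origin of the factor \<open>2n - 5\<close>, and the 4
    together with the preceding 6 gives 24.\<close>
  moreover have "real ((2 * N + 5) choose (N + 1)) =
      (real N + 2) / (4 * (2 * real N + 7)) * real ((2 * (N + 4)) choose (N + 4))"
  proof -
    have a: "real ((2 * N + 5) choose (N + 1)) = fact (2 * N + 5) / (fact (N + 1) * fact (N + 4))"
      using binomial_fact[of "N + 1" "2 * N + 5", where 'a = real] by (simp add: add.commute)
    have b: "real ((2 * (N + 4)) choose (N + 4)) = fact (2 * N + 8) / (fact (N + 4) * fact (N + 4))"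
      using binomial_fact[of "N + 4" "2 * (N + 4)", where 'a = real] by (simp add: add.commute)
    have c: "(fact (2 * N + 8) :: real) =
        (2 * real N + 8) * (2 * real N + 7) * (2 * real N + 6) * fact (2 * N + 5)"
    proof -
      have "2 * N + 8 - 1 = 2 * N + 7" "2 * N + 7 - 1 = 2 * N + 6" "2 * N + 6 - 1 = 2 * N + 5" by simp_all
      hence "(fact (2 * N + 8) :: real) =
          real (2 * N + 8) * (real (2 * N + 7) * (real (2 * N + 6) * fact (2 * N + 5)))"
        using fact_reduce[of "2 * N + 8", where 'a = real] fact_reduce[of "2 * N + 7", where 'a = real]
          fact_reduce[of "2 * N + 6", where 'a = real] by (simp add: add.commute)
      thus ?thesis by simp
    qed
    have d: "(fact (N + 4) :: real) = (real N + 4) * (real N + 3) * (real N + 2) * fact (N + 1)"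
      by (simp add: algebra_simps eval_nat_numeral)
    have pos: "(real N + 2) \<noteq> 0" "(2 * real N + 7) \<noteq> 0" "(real N + 3) \<noteq> 0" "(real N + 4) \<noteq> 0"
      by linarith+
    have "(fact (2 * N + 8) :: real) / fact (N + 4) =
        4 * (2 * real N + 7) / (real N + 2) * (fact (2 * N + 5) / fact (N + 1))"
      unfolding c d using pos by (simp add: divide_simps) (simp add: algebra_simps)
    thus ?thesis unfolding a b using pos by (simp add: divide_simps) (simp add: algebra_simps)
  qed
  moreover have "catalan (real n - 2) = real ((2 * (N + 4)) choose (N + 4)) / (real N + 5)"
  proof -
    have "real n - 2 = real (N + 4)" by (simp add: N)
    thus ?thesis by (simp only: catalan_of_nat) simp
  qed
  moreover define B where "B = real ((2 * (N + 4)) choose (N + 4))"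
  ultimately have
    "real (card (fixed_dissections n (n - 6) (int n))) =
      (real N + 3) * (real N + 2) * (real N + 1) / 6 * ((real N + 2) / (4 * (2 * real N + 7)) * B) / (real N + 5)"
    "catalan (real n - 2) = B / (real N + 5)"
    by (simp_all only:)
  moreover have "real n = real N + 6" by (simp add: N)
  ultimately show ?thesis
    by (simp only:) (simp add: divide_simps power2_eq_square, simp add: algebra_simps)
qed

lemma card_fixed_half:
  assumes "n \<ge> 6" "2 dvd n"
  shows "real (card (fixed_dissections n (n - 6) (int (n div 2)))) =
    (real n - 4)^2 / 4 * catalan (real n / 2 - 2)"
proof -
  \<comment> \<open>With \<open>n - 6 = 2 * M\<close>, the fixed dissections are the loop-free
    families of \<open>M\<close> arcs on \<open>M + 3\<close> points.\<close>
  obtain M where M: "n = 2 * (M + 3)"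
  proof -
    obtain m where "n = 2 * m" using assms(2) by (rule dvdE)
    thus ?thesis using that[of "m - 3"] assms(1) by simp
  qed
  define B where "B = real ((2 * M + 2) choose (M + 1))"
  have "fixed_dissections n (n - 6) (int (n div 2)) = {D \<in> periodic_dissections 2 (M + 3). card D = 2 * M}"
    using fixed_dissections_eq_periodic[of 2 "M + 3" "2 * M"] by (simp add: M)
  moreover have "card {D \<in> periodic_dissections 2 (M + 3). card D = 2 * M} =
      Suc M * ((2 * M + 2) choose M)"
  proof -
    have "M + 3 - 2 = Suc M" "M + 3 + M - 1 = 2 * M + 2" by simp_all
    thus ?thesis using periodic_dissections_card(1)[of 2 "M + 3" M] by simp
  qed
  ultimately have card: "real (card (fixed_dissections n (n - 6) (int (n div 2)))) =
      (real M + 1) * real ((2 * M + 2) choose M)"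
    by (simp only: of_nat_mult of_nat_Suc add.commute)
  \<comment> \<open>Both sides equal \<open>2M + 2\<close> times \<open>(2M + 1) choose M\<close>;
    the central binomial reached this way belongs to \<open>n/2 - 2 = M + 1\<close>.\<close>
  have "(M + 2) * ((2 * M + 2) choose M) = (M + 1) * ((2 * M + 2) choose (M + 1))"
  proof -
    have "2 * M + 2 - M = M + 2" "2 * M + 2 - 1 = 2 * M + 1" "Suc (2 * M + 1) = 2 * M + 2" "Suc M = M + 1"
      by simp_all
    thus ?thesis
      using binomial_absorb_comp[of "2 * M + 2" M] Suc_times_binomial[of M "2 * M + 1"]
      by (simp only:)
  qed
  hence "real (M + 2) * real ((2 * M + 2) choose M) = real (M + 1) * B"
    unfolding B_def by (simp only: of_nat_mult[symmetric])
  hence bin: "real ((2 * M + 2) choose M) = (real M + 1) * B / (real M + 2)"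
    by (simp add: field_simps)
  have "real n / 2 - 2 = real (M + 1)" "2 * M + 2 = 2 * (M + 1)" by (simp_all add: M field_simps)
  hence cat: "catalan (real n / 2 - 2) = B / (real M + 2)"
    by (simp only: catalan_of_nat B_def) simp
  have n: "real n - 4 = 2 * (real M + 1)" by (simp add: M)
  show ?thesis unfolding card bin cat n by (simp add: power2_eq_square field_simps)
qed

lemma card_fixed_third:
  assumes "n \<ge> 6" "3 dvd n"
  shows "real (card (fixed_dissections n (n - 6) (int (n div 3)))) =
    (real n - 3) * real n / 18 * catalan (real n / 3 - 1)"
proof -
  \<comment> \<open>Here \<open>n - 6 = 3 * M\<close>, so there are \<open>M\<close> arcs on
    \<open>M + 2\<close> points, with loops allowed.\<close>
  obtain M where M: "n = 3 * (M + 2)"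
  proof -
    obtain m where "n = 3 * m" using assms(2) by (rule dvdE)
    thus ?thesis using that[of "m - 2"] assms(1) by simp
  qed
  define B where "B = real ((2 * M + 2) choose (M + 1))"
  have "fixed_dissections n (n - 6) (int (n div 3)) = {D \<in> periodic_dissections 3 (M + 2). card D = 3 * M}"
    using fixed_dissections_eq_periodic[of 3 "M + 2" "3 * M"] by (simp add: M)
  moreover have "card {D \<in> periodic_dissections 3 (M + 2). card D = 3 * M} =
      Suc M * ((2 * M + 1) choose M)"
    using periodic_dissections_card(1)[of 3 "M + 2" M] by (simp add: mult_2)
  ultimately have card: "real (card (fixed_dissections n (n - 6) (int (n div 3)))) =
      (real M + 1) * real ((2 * M + 1) choose M)"
    by (simp only: of_nat_mult of_nat_Suc add.commute)
  \<comment> \<open>By symmetry the two middle entries of an odd row of Pascal's triangle are equal,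
    and they add up to the central entry below.\<close>
  have "2 * ((2 * M + 1) choose M) = (2 * M + 2) choose (M + 1)"
  proof -
    have "2 * M + 1 - M = Suc M" "2 * M + 2 = Suc (2 * M + 1)" "M + 1 = Suc M" "M \<le> 2 * M + 1" by simp_all
    thus ?thesis using binomial_symmetric[of M "2 * M + 1"] by (simp only: binomial_Suc_Suc mult_2)
  qed
  hence "real (2 * ((2 * M + 1) choose M)) = B" unfolding B_def by (simp only:)
  hence bin: "real ((2 * M + 1) choose M) = B / 2" by simp
  have "real n / 3 - 1 = real (M + 1)" "2 * M + 2 = 2 * (M + 1)" by (simp_all add: M field_simps)
  hence cat: "catalan (real n / 3 - 1) = B / (real M + 2)"
    by (simp only: catalan_of_nat B_def) simp
  have n: "real n - 3 = 3 * (real M + 1)" "real n = 3 * (real M + 2)" by (simp_all add: M)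
  show ?thesis unfolding card bin cat n(1) by (simp add: n(2) field_simps)
qed

lemma card_fixed_sixth:
  assumes "n \<ge> 6" "6 dvd n"
  shows "real (card (fixed_dissections n (n - 6) (int (n div 6)))) =
    real n / 6 * catalan (real n / 6 - 1)"
proof -
  \<comment> \<open>Now \<open>M\<close> arcs lie on \<open>M + 1\<close> points: the first binomial
    is \<open>M choose M\<close>, so every multiset of starts supports exactly one family.\<close>
  obtain M where M: "n = 6 * (M + 1)"
  proof -
    obtain m where "n = 6 * m" using assms(2) by (rule dvdE)
    thus ?thesis using that[of "m - 1"] assms(1) by simp
  qed
  have "fixed_dissections n (n - 6) (int (n div 6)) = {D \<in> periodic_dissections 6 (M + 1). card D = 6 * M}"
    using fixed_dissections_eq_periodic[of 6 "M + 1" "6 * M"] by (simp add: M)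
  hence card: "card (fixed_dissections n (n - 6) (int (n div 6))) = (2 * M) choose M"
    using periodic_dissections_card(1)[of 6 "M + 1" M] by (simp add: mult_2)
  have "real n / 6 - 1 = real M" by (simp add: M field_simps)
  hence cat: "catalan (real n / 6 - 1) = real ((2 * M) choose M) / (real M + 1)"
    by (simp only: catalan_of_nat)
  have "real n = 6 * (real M + 1)" by (simp add: M)
  thus ?thesis unfolding card cat by simp
qed

lemma fixed_dissections_empty:
  assumes n: "n \<ge> 6" and d: "d dvd n" "d \<notin> {1, 2, 3, 6}"
  shows "fixed_dissections n (n - 6) (int (n div d)) = {}"
proof (rule ccontr)
  assume "fixed_dissections n (n - 6) (int (n div d)) \<noteq> {}"
  then obtain D where D: "D \<in> fixed_dissections n (n - 6) (int (n div d))" by blast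
  have "d \<noteq> 0" using n d by (intro notI) simp
  hence d3: "d \<ge> 3" using d(2) by (cases d) auto
  have dm: "n = d * (n div d)" using d(1) by simp
  have m: "n div d \<ge> 1" using n dm by (cases "n div d") auto
  have "D \<in> periodic_dissections d (n div d)" "card D = n - 6"
    using D fixed_dissections_eq_periodic[of d "n div d" "n - 6"] d3 dm by auto
  hence "d dvd n - 6" using periodic_dissections_card(2)[of d "n div d" D] d3 m by simp
  hence "d dvd 6" using d(1) n by (metis dvd_diffD1)
  hence "d \<le> 6" by (rule dvd_imp_le) simp
  hence "d \<in> {3, 4, 5, 6}" using d3 by auto
  thus False using \<open>d dvd 6\<close> d(2) by auto
qed

theorem theorem4:
  fixes n :: nat
  assumes "n \<ge> 6"
  shows "real (card (dissection_classes n (n - 6))) =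
    ((real n - 3) * (real n - 4)^2 * (real n - 5)) / (24 * real n * (2 * real n - 5))
        * catalan (real n - 2)
    + (real n - 4)^2 / (4 * real n) * catalan (real n / 2 - 2)
    + (real n - 3) / 9 * catalan (real n / 3 - 1)
    + 1 / 3 * catalan (real n / 6 - 1)"
proof -
  let ?h = "\<lambda>d. totient d * card (fixed_dissections n (n - 6) (int (n div d)))"
  \<comment> \<open>Non-divisors get the value 0, so the sum can run over the fixed set
    \<open>{1, 2, 3, 6}\<close> for every \<open>n\<close>.\<close>
  let ?h' = "\<lambda>d. if d dvd n then real (?h d) else 0"
  have "n > 0" using assms by simp
  \<comment> \<open>Orders 3 and 6 each belong to two rotations, which turns the denominators 18 and
    6 into 9 and 3.\<close>
  have tot: "totient 3 = 2" "totient 6 = 2"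
  proof -
    show "totient 3 = 2" using totient_prime[of 3] by simp
    have "coprime 2 (3 :: nat)" by simp
    thus "totient 6 = 2" using totient_mult_coprime[of 2 3] \<open>totient 3 = 2\<close> by simp
  qed
  have "real (card (dissection_classes n (n - 6)) * n) = (\<Sum>d | d dvd n. real (?h d))"
    by (simp only: dissection_classes_totient_sum[OF \<open>n > 0\<close>] of_nat_sum)
  also have "\<dots> = (\<Sum>d\<in>{1, 2, 3, 6}. ?h' d)"
  proof -
    have "(\<Sum>d | d dvd n. real (?h d)) = (\<Sum>d | d dvd n. ?h' d)" by (rule sum.cong) auto
    also have "\<dots> = (\<Sum>d\<in>{d. d dvd n} \<inter> {1, 2, 3, 6}. ?h' d)"
      using assms \<open>n > 0\<close> fixed_dissections_empty
      by (intro sum.mono_neutral_right) (auto simp: finite_divisors_nat)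
    also have "\<dots> = (\<Sum>d\<in>{1, 2, 3, 6}. ?h' d)"
      by (intro sum.mono_neutral_left) auto
    finally show ?thesis .
  qed
  also have "\<dots> = ?h' 1 + ?h' 2 + ?h' 3 + ?h' 6" by simp
  also have "?h' 1 =
      ((real n - 3) * (real n - 4)^2 * (real n - 5)) / (24 * (2 * real n - 5)) * catalan (real n - 2)"
    using card_fixed_whole[OF assms] by simp
  also have "?h' 2 = (real n - 4)^2 / 4 * catalan (real n / 2 - 2)"
    using card_fixed_half[OF assms] catalan_divide_not_dvd[of 2 n 2] by simp
  also have "?h' 3 = (real n - 3) * real n / 9 * catalan (real n / 3 - 1)"
    using card_fixed_third[OF assms] catalan_divide_not_dvd[of 3 n 1] tot(1) by (auto simp: field_simps)
  also have "?h' 6 = real n / 3 * catalan (real n / 6 - 1)"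
    using card_fixed_sixth[OF assms] catalan_divide_not_dvd[of 6 n 1] tot(2) by (auto simp: field_simps)
  finally have "real (card (dissection_classes n (n - 6))) * real n =
      ((real n - 3) * (real n - 4)^2 * (real n - 5)) / (24 * (2 * real n - 5)) * catalan (real n - 2)
      + (real n - 4)^2 / 4 * catalan (real n / 2 - 2)
      + (real n - 3) * real n / 9 * catalan (real n / 3 - 1)
      + real n / 3 * catalan (real n / 6 - 1)" by simp
  hence "real (card (dissection_classes n (n - 6))) =
      (((real n - 3) * (real n - 4)^2 * (real n - 5)) / (24 * (2 * real n - 5)) * catalan (real n - 2)
      + (real n - 4)^2 / 4 * catalan (real n / 2 - 2)
      + (real n - 3) * real n / 9 * catalan (real n / 3 - 1)
      + real n / 3 * catalan (real n / 6 - 1)) / real n"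
    using \<open>n > 0\<close> by (simp add: eq_divide_eq)
  also have "\<dots> = ((real n - 3) * (real n - 4)^2 * (real n - 5)) / (24 * real n * (2 * real n - 5))
        * catalan (real n - 2)
    + (real n - 4)^2 / (4 * real n) * catalan (real n / 2 - 2)
    + (real n - 3) / 9 * catalan (real n / 3 - 1)
    + 1 / 3 * catalan (real n / 6 - 1)"
    using \<open>n > 0\<close> by (simp add: add_divide_distrib mult.commute mult.left_commute)
  finally show ?thesis .
qed

end
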